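(* Let $\mu$ be a positive measure on the unit circle $\mathbb{T}=\{z=e^{i\theta}:0\le\theta\le 2\pi\}$, finite and with infinite support, let $\mathfrak{q}\in\mathbb{C}$, and for $t\in\mathbb{R}$ let $d\mu^{(t)}(z)=e^{-t(\overline{\mathfrak{q}}z+\mathfrak{q}/z)}d\mu(z)$. Let $c_n=c_n(t)$ $(n\ge 1)$ and $d_{n}=d_{n}(t)$ $(n\ge 2)$ be the real coefficients of the three term recurrence relation $$R_{n+1}(z;t)=[(1+ic_{n+1}(t))z+(1-ic_{n+1}(t))]R_n(z;t)-4d_{n+1}(t)\,z\,R_{n-1}(z;t),\quad n\ge 1,$$ $R_0(z;t)=1$, $R_1(z;t)=(1+ic_1(t))z+(1-ic_1(t))$, satisfied by the normalized kernel polynomials $R_n(z;t)$ of $\mu^{(t)}$ at the point $1$ (see context). Put $c_0(t)=1$ and $d_1(t)=0$. Then (a dot denoting $d/dt$) $$\dot c_1=-4\operatorname{Re}(\mathfrak{q})\left[\frac{d_2(c_1+c_2)}{1+c_2^2}\right]-4\operatorname{Im}(\mathfrak{q})\left[\frac{d_2(1-c_1c_2)}{1+c_2^2}\right],$$ and, for $n\ge 2$, $$\dot c_n=4\operatorname{Re}(\mathfrak{q})\left[\frac{d_n(c_n+c_{n-1})}{1+c_{n-1}^2}-\frac{d_{n+1}(c_n+c_{n+1})}{1+c_{n+1}^2}\right]+4\operatorname{Im}(\mathfrak{q})\left[\frac{d_n(1-c_nc_{n-1})}{1+c_{n-1}^2}-\frac{d_{n+1}(1-c_nc_{n+1})}{1+c_{n+1}^2}\right]$$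 and $$\dot d_n=4\operatorname{Re}(\mathfrak{q})\left[\frac{d_nd_{n-1}}{1+c_{n-2}^2}-\frac{d_nd_{n+1}}{1+c_{n+1}^2}+\frac{d_n(1-d_n)(c_{n-1}^2-c_n^2)}{(1+c_n^2)(1+c_{n-1}^2)}\right]$$ $$\qquad-4\operatorname{Im}(\mathfrak{q})\left[\frac{d_nd_{n-1}c_{n-2}}{1+c_{n-2}^2}-\frac{d_nd_{n+1}c_{n+1}}{1+c_{n+1}^2}+\frac{d_n(1-d_n)(c_n-c_{n-1})(1-c_nc_{n-1})}{(1+c_n^2)(1+c_{n-1}^2)}\right].$$
   Context: For each $t\in\mathbb{R}$, $\mu^{(t)}$ is a positive measure on $\mathbb{T}$. Let $\Phi_n(z;t)$ and $\varphi_n(z;t)$, $n\ge0$, be respectively the monic orthogonal and the orthonormal polynomials on the unit circle with respect to $\mu^{(t)}$, $\Phi_n^*(z;t)=z^n\overline{\Phi_n(1/\overline{z};t)}$ the reciprocal polynomial, $\mathfrak{a}_n(t)=-\overline{\Phi_{n+1}(0;t)}$, $n\ge 0$, the Verblunsky coefficients, and $\rho_n^{(t)}=\Phi_n(1;t)/\Phi_n^*(1;t)$, $n\geq 0$. The kernel (Christoffel–Darboux) polynomials are $K_n^{(t)}(z,w)=\sum_{j=0}^n\overline{\varphi_j(w;t)}\,\varphi_j(z;t)$. Define $$g_n(t)=\frac12\,\frac{|1-\rho_{n-1}^{(t)}\mathfrak{a}_{n-1}(t)|^2}{1-\operatorname{Re}[\rho_{n-1}^{(t)}\mathfrak{a}_{n-1}(t)]}\in(0,1),\quad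 n\ge 1,$$ $\xi_0(t)=\int_{\mathbb{T}}d\mu^{(t)}$, $\xi_n(t)=\xi_0(t)\prod_{j=1}^n(1-g_j(t))$ for $n\geq 1$, and $R_n(z;t)=\xi_n(t)K_n^{(t)}(z,1)$, $n\ge 0$. It is known that the $R_n(z;t)$ satisfy the recurrence in the claim with $$c_n(t)=\frac{\operatorname{Im}(\rho_{n-1}^{(t)}\mathfrak{a}_{n-1}(t))}{\operatorname{Re}(\rho_{n-1}^{(t)}\mathfrak{a}_{n-1}(t))-1}\in\mathbb{R},\qquad d_{n+1}(t)=[1-g_n(t)]\,g_{n+1}(t),\quad n\ge 1.$$ It is also known that the monic kernel polynomials $Q_n(z;t)=R_n(z;t)/\prod_{k=1}^n(1+ic_k(t))$ are characterized by: $Q_n$ is monic of degree $n$ and $\int_{\mathbb{T}}z^{-n+s}Q_n(z;t)(z-1)\,d\mu^{(t)}(z)=0$ for $s=0,\dots,n-1$.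
   Formalization: The normalized kernel polynomials are taken as R_n = 2^n ξ_n K_n(z,1) instead of ξ_n K_n(z,1): without the factor 2^n the stated R_1 and recurrence fail (for Lebesgue measure, ξ_1 K_1(z,1) = (z+1)/2, not z+1). The coefficients c_n, d_n and the differential equations are unchanged. *)

theory Defs
  imports "HOL-Analysis.Analysis" "HOL-Computational_Algebra.Polynomial"
begin

definition unit_circle_measure :: "complex measure \<Rightarrow> bool" where
  "unit_circle_measure M \<longleftrightarrow>
     finite_measure M \<and> sets M = sets (restrict_space borel (sphere 0 1))"

definition measure_support :: "complex measure \<Rightarrow> complex set" where
  "measure_support M =
     {z \<in> space M. \<forall>U. open U \<and> z \<in> U \<longrightarrow> emeasure M (U \<inter> space M) > 0}"

text \<open>
  For \<open>z\<close> on the unit circle the exponent \<open>- t (cnj q z + q / z) = - 2 t Re (cnj q z)\<close> is real,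
  so taking the real part only converts the weight to a real number.
\<close>
definition deformed_measure :: "complex measure \<Rightarrow> complex \<Rightarrow> real \<Rightarrow> complex measure" where
  "deformed_measure M q t =
     density M (\<lambda>z. ennreal (Re (exp (- of_real t * (cnj q * z + q / z)))))"

definition monic_op :: "complex measure \<Rightarrow> nat \<Rightarrow> complex poly" where
  "monic_op M n =
     (THE p. degree p = n \<and> lead_coeff p = 1 \<and>
        (\<forall>k<n. (LINT z|M. poly p z * cnj (z ^ k)) = 0))"

definition orthonormal_op :: "complex measure \<Rightarrow> nat \<Rightarrow> complex poly" where
  "orthonormal_op M n =
     smult (of_real (1 / sqrt (LINT z|M. (cmod (poly (monic_op M n) z))\<^sup>2))) (monic_op M n)"

text \<open>
  The coefficients are conjugated and reversed; as \<^term>\<open>monic_op M n\<close> has degree \<open>n\<close>, this is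
  \<open>z^n * cnj (poly (monic_op M n) (1 / cnj z))\<close> for \<open>z \<noteq> 0\<close>.
\<close>
definition reciprocal_op :: "complex measure \<Rightarrow> nat \<Rightarrow> complex poly" where
  "reciprocal_op M n = reflect_poly (map_poly cnj (monic_op M n))"

definition verblunsky :: "complex measure \<Rightarrow> nat \<Rightarrow> complex" where
  "verblunsky M n = - cnj (poly (monic_op M (Suc n)) 0)"

definition op_rho :: "complex measure \<Rightarrow> nat \<Rightarrow> complex" where
  "op_rho M n = poly (monic_op M n) 1 / poly (reciprocal_op M n) 1"

definition CD_kernel :: "complex measure \<Rightarrow> nat \<Rightarrow> complex \<Rightarrow> complex \<Rightarrow> complex" where
  "CD_kernel M n z w =
     (\<Sum>j\<le>n. cnj (poly (orthonormal_op M j) w) * poly (orthonormal_op M j) z)"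

text \<open>
  \<open>kernel_g\<close> and \<open>kernel_c\<close> are meaningful for indices \<open>n \<ge> 1\<close>, and \<open>kernel_d\<close> for \<open>n \<ge> 2\<close>.
\<close>
definition kernel_g :: "complex measure \<Rightarrow> nat \<Rightarrow> real" where
  "kernel_g M n =
     1 / 2 * ((cmod (1 - op_rho M (n - 1) * verblunsky M (n - 1)))\<^sup>2 /
              (1 - Re (op_rho M (n - 1) * verblunsky M (n - 1))))"

definition kernel_c :: "complex measure \<Rightarrow> nat \<Rightarrow> real" where
  "kernel_c M n =
     Im (op_rho M (n - 1) * verblunsky M (n - 1)) /
     (Re (op_rho M (n - 1) * verblunsky M (n - 1)) - 1)"

definition kernel_d :: "complex measure \<Rightarrow> nat \<Rightarrow> real" where
  "kernel_d M n = (1 - kernel_g M (n - 1)) * kernel_g M n"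

definition kernel_xi :: "complex measure \<Rightarrow> nat \<Rightarrow> real" where
  "kernel_xi M n = measure M (space M) * (\<Prod>j=1..n. 1 - kernel_g M j)"

text \<open>
  The factor \<open>2 ^ n\<close> is forced by the three term recurrence: for \<open>n = 1\<close>,
  \<open>kernel_xi M 1 * CD_kernel M 1 z 1 = ((1 + i c) z + (1 - i c)) / 2\<close> with \<open>c = kernel_c M 1\<close>.
\<close>
definition kernel_R :: "complex measure \<Rightarrow> nat \<Rightarrow> complex \<Rightarrow> complex" where
  "kernel_R M n z = 2 ^ n * of_real (kernel_xi M n) * CD_kernel M n z 1"

end

theory Submission
  imports Defs
begin

text \<open>
  Put \<open>w_n = rho_n a_n\<close>. Then \<open>1 - w_n = 2 g_{n+1} / (1 - i c_{n+1})\<close>, so the sequences \<open>(g_n)\<close> and \<open>(c_n)\<close>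
  are rational in \<open>Re w_n\<close> and \<open>Im w_n\<close>. The kernel polynomials satisfy
  \<open>R_{n+1} = 2 (1 - g_{n+1}) R_n + (1 + i c_1) ... (1 + i c_{n+1}) Phi_{n+1}\<close>, and this together with the
  Christoffel-Darboux formula \<open>(z - 1) R_n = (1 + i c_1) ... (1 + i c_n) (z Phi_n - rho_n Phi_n^*)\<close> yields
  the three term recurrence.

  Differentiating the orthogonality relations in \<open>t\<close> identifies the derivative of \<open>Phi_{n+1}\<close> as
  \<open>(1 - |a_n|^2) (q Phi_n + conj(q a_{n+1}) Phi_n^*)\<close>. Evaluated at \<open>0\<close> this is the Schur flow
  \<open>a_n' = (1 - |a_n|^2) (conj(q) a_{n-1} - q a_{n+1})\<close>, \<open>a_{-1} = -1\<close>; evaluated at \<open>1\<close> it is a local formula for the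
  derivative of \<open>rho_n\<close>. Both give the derivative of \<open>w_n\<close>, hence of \<open>g_n\<close>, \<open>c_n\<close> and
  \<open>d_{n+1} = (1 - g_n) g_{n+1}\<close>.
\<close>

section \<open>Orthogonal polynomials on the unit circle\<close>

locale circle_measure =
  fixes M :: "complex measure"
  assumes unit_circle_measure: "unit_circle_measure M"
    and infinite_support: "infinite (measure_support M)"
begin

sublocale finite_measure M
  using unit_circle_measure by (simp add: unit_circle_measure_def)

lemma sets_eq: "sets M = sets (restrict_space borel (sphere 0 1))"
  using unit_circle_measure by (simp add: unit_circle_measure_def)

lemma space_eq: "space M = sphere 0 1"
  using sets_eq_imp_space_eq[OF sets_eq] by (simp add: space_restrict_space)

lemma open_Int_space: "open U \<Longrightarrow> U \<inter> space M \<in> sets M"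
  using imageI[of U "sets borel" "(\<inter>) (sphere 0 1)"]
  by (simp add: sets_eq space_eq sets_restrict_space Int_commute)

lemma borel_measurable_continuous:
  fixes f :: "complex \<Rightarrow> 'b::{banach,second_countable_topology}"
  assumes "continuous_on (sphere 0 1) f"
  shows "f \<in> borel_measurable M"
  using borel_measurable_continuous_on_restrict[OF assms] measurable_cong_sets[OF sets_eq refl] by blast

lemma integrable_continuous:
  fixes f :: "complex \<Rightarrow> 'b::{banach,second_countable_topology}"
  assumes "continuous_on (sphere 0 1) f"
  shows "integrable M f"
proof -
  have "compact (f ` sphere 0 1)"
    using assms compact_continuous_image compact_sphere by blast
  then obtain B where "\<And>z. z \<in> sphere 0 1 \<Longrightarrow> norm (f z) \<le> B"
    using compact_imp_bounded bounded_iff by (metis imageI)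
  then show ?thesis
    using borel_measurable_continuous[OF assms]
    by (intro integrable_const_bound[where B=B]) (auto simp: space_eq)
qed

lemma cnj_eq_inverse: "z \<in> space M \<Longrightarrow> cnj z = inverse z"
  by (simp add: space_eq inverse_complex_def cnj_def complex_eq_iff cmod_def)

lemma mult_cnj_self: "z \<in> space M \<Longrightarrow> z * cnj z = 1"
  by (metis cnj_eq_inverse space_eq mem_sphere_0 norm_zero right_inverse zero_neq_one)

section \<open>Inner products with powers of z, shifts and reflection\<close>

definition mom :: "complex poly \<Rightarrow> nat \<Rightarrow> complex" where
  "mom p k = (LINT z|M. poly p z * cnj (z ^ k))"

lemma integrable_mom [simp, intro]: "integrable M (\<lambda>z. poly p z * cnj (z ^ k))"
  by (intro integrable_continuous continuous_intros)

lemma mom_diff: "mom (p - r) k = mom p k - mom r k"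
  by (simp add: mom_def left_diff_distrib del: complex_cnj_power)

lemma mom_add: "mom (p + r) k = mom p k + mom r k"
  by (simp add: mom_def distrib_right del: complex_cnj_power)

lemma mom_smult: "mom (smult a p) k = a * mom p k"
  by (simp add: mom_def mult.assoc del: complex_cnj_power)

text \<open>Multiplication by z is unitary on the circle, so it can be cancelled against one power
  of the test function.\<close>

lemma mom_pCons_Suc: "mom (pCons 0 p) (Suc k) = mom p k"
  unfolding mom_def
proof (rule Bochner_Integration.integral_cong)
  fix z assume "z \<in> space M"
  then have "z * cnj z = 1" by (rule mult_cnj_self)
  then show "poly (pCons 0 p) z * cnj (z ^ Suc k) = poly p z * cnj (z ^ k)"
    by (simp add: algebra_simps)
qed simp

lemma poly_reflect_cnj:
  assumes "z \<in> space M"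
  shows "poly (reflect_poly (map_poly cnj p)) z = z ^ degree p * cnj (poly p z)"
proof -
  have z: "z \<noteq> 0" using assms space_eq by auto
  have "degree (map_poly cnj p) = degree p" by (rule degree_map_poly) auto
  moreover have "poly (map_poly cnj p) (inverse z) = cnj (poly p z)"
    using cnj_eq_inverse[OF assms] poly_cnj[of p z] by simp
  ultimately show ?thesis by (simp add: poly_reflect_poly_nz z)
qed

text \<open>By \<open>poly_reflect_cnj\<close>, reflection is conjugation followed by multiplication
  with a power of z, so the test powers k and \<open>degree p - k\<close> change places. If p is
  orthogonal to all lower powers, its reflection is therefore orthogonal to z, ..., z^n, with n its
  degree.\<close>

lemma mom_reflect:
  assumes "k \<le> degree p"
  shows "mom (reflect_poly (map_poly cnj p)) k = cnj (mom p (degree p - k))"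
proof -
  have "mom (reflect_poly (map_poly cnj p)) k = (LINT z|M. cnj (poly p z * cnj (z ^ (degree p - k))))"
    unfolding mom_def
  proof (rule Bochner_Integration.integral_cong)
    fix z assume z: "z \<in> space M"
    have "z ^ degree p * cnj z ^ k = z ^ (degree p - k) * (z * cnj z) ^ k"
      using assms by (simp add: power_mult_distrib flip: power_add mult.assoc)
    then show "poly (reflect_poly (map_poly cnj p)) z * cnj (z ^ k) = cnj (poly p z * cnj (z ^ (degree p - k)))"
      by (simp add: poly_reflect_cnj[OF z] mult_cnj_self[OF z] algebra_simps)
  qed simp
  also have "\<dots> = cnj (mom p (degree p - k))" by (simp only: mom_def Bochner_Integration.integral_cnj)
  finally show ?thesis .
qed

text \<open>The first exponent beyond the range of \<open>mom_reflect\<close>; it feeds the norm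
  recursion \<open>\<kappa>_Suc\<close>.\<close>

lemma mom_reflect_Suc:
  "mom (reflect_poly (map_poly cnj p)) (Suc (degree p)) = cnj (mom (pCons 0 p) 0)"
proof -
  have "mom (reflect_poly (map_poly cnj p)) (Suc (degree p)) = (LINT z|M. cnj (z * poly p z))"
    unfolding mom_def
  proof (rule Bochner_Integration.integral_cong)
    fix z assume z: "z \<in> space M"
    have "z ^ degree p * cnj z ^ Suc (degree p) = cnj z * (z * cnj z) ^ degree p"
      by (simp add: power_mult_distrib algebra_simps)
    then have "z ^ degree p * cnj z ^ Suc (degree p) = cnj z" by (simp add: mult_cnj_self[OF z])
    then show "poly (reflect_poly (map_poly cnj p)) z * cnj (z ^ Suc (degree p)) = cnj (z * poly p z)"
      by (simp add: poly_reflect_cnj[OF z] mult.commute mult.left_commute del: power_Suc)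
  qed simp
  also have "\<dots> = cnj (mom (pCons 0 p) 0)" by (simp only: mom_def Bochner_Integration.integral_cnj)
       (simp flip: Bochner_Integration.integral_cnj)
  finally show ?thesis .
qed

section \<open>Positivity, uniqueness and existence of the monic orthogonal polynomials\<close>

lemma inner_poly:
  "(LINT z|M. poly p z * cnj (poly r z)) = (\<Sum>i\<le>degree r. cnj (coeff r i) * mom p i)"
proof -
  have "(LINT z|M. poly p z * cnj (poly r z)) =
      (LINT z|M. (\<Sum>i\<le>degree r. cnj (coeff r i) * (poly p z * cnj (z ^ i))))"
    by (simp add: poly_altdef sum_distrib_left algebra_simps)
  also have "\<dots> = (\<Sum>i\<le>degree r. cnj (coeff r i) * mom p i)"
    by (simp add: mom_def Bochner_Integration.integral_sum del: complex_cnj_power)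
  finally show ?thesis .
qed

lemma inner_self: "(LINT z|M. poly p z * cnj (poly p z)) = of_real (LINT z|M. (cmod (poly p z))\<^sup>2)"
  by (simp add: complex_norm_square [symmetric] del: of_real_power)

text \<open>If the integral vanished, p would be zero almost everywhere. Its nonzero set is open, so
  p would vanish on the whole support, which is infinite, whereas p has finitely many roots.\<close>

lemma sq_norm_pos:
  assumes "p \<noteq> 0"
  shows "(LINT z|M. (cmod (poly p z))\<^sup>2) > 0"
proof (rule ccontr)
  assume "\<not> ?thesis"
  moreover have "(LINT z|M. (cmod (poly p z))\<^sup>2) \<ge> 0" by simp
  ultimately have "(LINT z|M. (cmod (poly p z))\<^sup>2) = 0" by linarith
  moreover have "integrable M (\<lambda>z. (cmod (poly p z))\<^sup>2)"
    by (intro integrable_continuous continuous_intros)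
  ultimately have AE: "AE z in M. poly p z = 0"
    by (subst (asm) integral_nonneg_eq_0_iff_AE) auto
  have "measure_support M \<subseteq> {z. poly p z = 0}"
  proof
    fix z assume z: "z \<in> measure_support M"
    show "z \<in> {z. poly p z = 0}"
    proof (rule ccontr)
      let ?U = "{z. poly p z \<noteq> 0}"
      assume "z \<notin> {z. poly p z = 0}"
      moreover have "open ?U" by (intro open_Collect_neq continuous_intros)
      ultimately have pos: "emeasure M (?U \<inter> space M) > 0"
        using z by (auto simp: measure_support_def)
      have "AE z in M. z \<notin> ?U \<inter> space M" using AE by eventually_elim auto
      moreover have "?U \<inter> space M \<in> sets M"
        using \<open>open ?U\<close> by (rule open_Int_space)
      ultimately have "emeasure M (?U \<inter> space M) = 0"
        by (simp add: AE_iff_null_sets null_setsD1)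
      then show False using pos by simp
    qed
  qed
  then show False
    using poly_roots_finite[OF assms] infinite_support finite_subset by blast
qed

text \<open>By linearity such a p is orthogonal to itself. This gives uniqueness of the orthogonal
  polynomials and later identifies their t-derivative. The disjunct \<open>p = 0\<close> covers n =
  0.\<close>

lemma eq_0_if_orthogonal:
  assumes "p = 0 \<or> degree p < n" "\<And>k. k < n \<Longrightarrow> mom p k = 0"
  shows "p = 0"
proof (rule ccontr)
  assume p: "p \<noteq> 0"
  have "complex_of_real (LINT z|M. (cmod (poly p z))\<^sup>2) = 0"
    using assms p by (auto simp: inner_self [symmetric] inner_poly)
  then show False using sq_norm_pos[OF p] by simp
qed

definition monic_orthogonal :: "nat \<Rightarrow> complex poly \<Rightarrow> bool" where
  "monic_orthogonal n p \<longleftrightarrow> degree p = n \<and> lead_coeff p = 1 \<and> (\<forall>k<n. mom p k = 0)"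

lemma monic_orthogonal_unique:
  assumes p: "monic_orthogonal n p" and r: "monic_orthogonal n r"
  shows "p = r"
proof -
  have "p - r = 0 \<or> degree (p - r) < n"
  proof (cases n)
    case 0
    then show ?thesis using p r by (auto simp: monic_orthogonal_def elim!: degree_eq_zeroE)
  next
    case (Suc m)
    have "coeff (p - r) i = 0" if "i > m" for i
      using p r that Suc
      by (cases "i = n") (auto simp: monic_orthogonal_def coeff_eq_0)
    then show ?thesis using Suc degree_le[of m "p - r"] by auto
  qed
  then have "p - r = 0"
    by (rule eq_0_if_orthogonal) (use p r in \<open>auto simp: monic_orthogonal_def mom_diff\<close>)
  then show ?thesis by simp
qed

lemma mom_degree:
  assumes "monic_orthogonal n p"
  shows "mom p n = of_real (LINT z|M. (cmod (poly p z))\<^sup>2)"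
proof -
  have "(LINT z|M. poly p z * cnj (poly p z)) = (\<Sum>i\<le>n. cnj (coeff p i) * mom p i)"
    using inner_poly[of p p] assms by (simp add: monic_orthogonal_def)
  also have "\<dots> = (\<Sum>i\<in>{n}. cnj (coeff p i) * mom p i)"
    using assms by (intro sum.mono_neutral_right) (auto simp: monic_orthogonal_def)
  finally show ?thesis using assms by (auto simp: monic_orthogonal_def inner_self)
qed

text \<open>Both z p and the reflection of p are orthogonal to z, ..., z^n, so only the inner
  product with 1 has to be removed. For the reflection it equals the real number
  \<open>mom p n\<close>, which fixes a.\<close>

lemma monic_orthogonal_step:
  assumes p: "monic_orthogonal n p"
  defines "a \<equiv> mom (pCons 0 p) 0 / mom p n"
  shows "monic_orthogonal (Suc n) (pCons 0 p - smult a (reflect_poly (map_poly cnj p)))"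
    (is "monic_orthogonal _ ?r")
proof -
  have p': "degree p = n" "lead_coeff p = 1" "\<And>k. k < n \<Longrightarrow> mom p k = 0" "p \<noteq> 0"
    using p by (auto simp: monic_orthogonal_def)
  have deg: "degree (reflect_poly (map_poly cnj p)) \<le> n"
    using degree_reflect_poly_le[of "map_poly cnj p"] degree_map_poly[of cnj p] p' by simp
  have coeff: "coeff ?r (Suc n) = 1"
    using deg p' by (simp add: coeff_eq_0)
  have "degree ?r \<le> Suc n"
    using deg p' by (intro degree_diff_le) (auto simp: degree_pCons_eq intro: order.trans[OF degree_smult_le])
  with coeff have d: "degree ?r = Suc n"
    using le_degree[of ?r "Suc n"] by simp
  have nz: "mom p n \<noteq> 0" using mom_degree[OF p] sq_norm_pos[OF p'(4)] by simp
  have "mom ?r k = 0" if k: "k < Suc n" for k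
  proof (cases k)
    case 0
    have "cnj (mom p n) = mom p n" by (simp add: mom_degree[OF p])
    then show ?thesis using 0 p' nz by (simp add: mom_diff mom_smult mom_reflect a_def)
  next
    case (Suc j)
    then show ?thesis using k p' by (simp add: mom_diff mom_smult mom_reflect mom_pCons_Suc)
  qed
  then show ?thesis using d coeff by (simp add: monic_orthogonal_def)
qed

lemma monic_orthogonal_exists: "\<exists>p. monic_orthogonal n p"
proof (induction n)
  case 0
  have "monic_orthogonal 0 1" by (simp add: monic_orthogonal_def)
  then show ?case ..
next
  case (Suc n)
  then show ?case using monic_orthogonal_step by blast
qed

section \<open>The Szego recurrence and the Verblunsky coefficients\<close>

abbreviation "\<Phi> \<equiv> monic_op M"
abbreviation "\<Phi>r \<equiv> reciprocal_op M"
abbreviation "\<alpha> \<equiv> verblunsky M"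

lemma monic_op: "monic_orthogonal n (\<Phi> n)"
proof -
  have "\<Phi> n = (THE p. monic_orthogonal n p)"
    by (simp add: monic_op_def monic_orthogonal_def mom_def)
  then show ?thesis
    using monic_orthogonal_exists monic_orthogonal_unique by (metis theI)
qed

lemma monic_op_eqI: "monic_orthogonal n p \<Longrightarrow> \<Phi> n = p"
  using monic_op monic_orthogonal_unique by blast

lemma degree_monic_op: "degree (\<Phi> n) = n"
  and lead_coeff_monic_op: "coeff (\<Phi> n) n = 1"
  and mom_monic_op: "k < n \<Longrightarrow> mom (\<Phi> n) k = 0"
  using monic_op[of n] by (auto simp: monic_orthogonal_def)

lemma monic_op_nonzero: "\<Phi> n \<noteq> 0"
  using lead_coeff_monic_op[of n] by auto

lemma monic_op_0: "\<Phi> 0 = 1"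
  by (rule monic_op_eqI) (simp add: monic_orthogonal_def)

definition \<kappa> :: "nat \<Rightarrow> real" where
  "\<kappa> n = (LINT z|M. (cmod (poly (\<Phi> n) z))\<^sup>2)"

lemma \<kappa>_pos: "\<kappa> n > 0"
  unfolding \<kappa>_def by (rule sq_norm_pos[OF monic_op_nonzero])

lemma mom_monic_op_self: "mom (\<Phi> n) n = of_real (\<kappa> n)"
  unfolding \<kappa>_def by (rule mom_degree[OF monic_op])

lemma mom_reciprocal_op: "k \<le> n \<Longrightarrow> mom (\<Phi>r n) k = (if k = 0 then of_real (\<kappa> n) else 0)"
  using mom_reflect[of k "\<Phi> n"] by (simp add: reciprocal_op_def degree_monic_op mom_monic_op mom_monic_op_self)

lemma coeff_reciprocal_op: "coeff (\<Phi>r n) i = (if i \<le> n then cnj (coeff (\<Phi> n) (n - i)) else 0)"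
  using degree_map_poly[of cnj "\<Phi> n"]
  by (simp add: reciprocal_op_def coeff_reflect_poly degree_monic_op coeff_map_poly)

lemma degree_reciprocal_op: "degree (\<Phi>r n) \<le> n"
  by (rule degree_le) (simp add: coeff_reciprocal_op)

lemma poly_reciprocal_op_0: "poly (\<Phi>r n) 0 = 1"
  by (simp add: poly_0_coeff_0 coeff_reciprocal_op lead_coeff_monic_op)

lemma poly_reciprocal_op_1: "poly (\<Phi>r n) 1 = cnj (poly (\<Phi> n) 1)"
  using poly_cnj[of "\<Phi> n" 1] by (simp add: reciprocal_op_def poly_reflect_poly_nz)

lemma szego: "\<Phi> (Suc n) = pCons 0 (\<Phi> n) - smult (cnj (\<alpha> n)) (\<Phi>r n)"
  and cnj_verblunsky: "cnj (\<alpha> n) = mom (pCons 0 (\<Phi> n)) 0 / of_real (\<kappa> n)"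
proof -
  let ?a = "mom (pCons 0 (\<Phi> n)) 0 / of_real (\<kappa> n)"
  have 1: "\<Phi> (Suc n) = pCons 0 (\<Phi> n) - smult ?a (\<Phi>r n)"
    using monic_orthogonal_step[OF monic_op[of n]]
    by (intro monic_op_eqI) (simp add: mom_monic_op_self reciprocal_op_def)
  then have "poly (\<Phi> (Suc n)) 0 = - ?a" by (simp add: poly_reciprocal_op_0)
  then show "cnj (\<alpha> n) = ?a" by (simp add: verblunsky_def)
  then show "\<Phi> (Suc n) = pCons 0 (\<Phi> n) - smult (cnj (\<alpha> n)) (\<Phi>r n)" using 1 by simp
qed

lemma mom_pCons_monic_op: "k \<le> n \<Longrightarrow>
    mom (pCons 0 (\<Phi> n)) k = (if k = 0 then cnj (\<alpha> n) * of_real (\<kappa> n) else 0)"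
  using cnj_verblunsky[of n] \<kappa>_pos[of n]
  by (cases k) (auto simp: mom_pCons_Suc mom_monic_op)

text \<open>Pair the Szego recurrence with z^(n+1); by \<open>mom_reflect_Suc\<close> the reversed
  polynomial contributes \<open>\<alpha> n * \<kappa> n\<close>. Positivity of both norms then
  forces the Verblunsky coefficients into the unit disc.\<close>

lemma \<kappa>_Suc: "\<kappa> (Suc n) = (1 - (cmod (\<alpha> n))\<^sup>2) * \<kappa> n"
proof -
  have "complex_of_real (\<kappa> (Suc n)) = mom (\<Phi> (Suc n)) (Suc n)" by (simp add: mom_monic_op_self)
  also have "\<dots> = of_real (\<kappa> n) - cnj (\<alpha> n) * (\<alpha> n * of_real (\<kappa> n))"
    using mom_reflect_Suc[of "\<Phi> n"]
    by (simp add: szego mom_diff mom_smult mom_pCons_Suc mom_monic_op_self reciprocal_op_def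
        degree_monic_op mom_pCons_monic_op)
  also have "\<dots> = of_real ((1 - (cmod (\<alpha> n))\<^sup>2) * \<kappa> n)"
    using complex_norm_square[of "\<alpha> n"] by (simp add: algebra_simps)
  finally show ?thesis by (simp only: of_real_eq_iff)
qed

lemma cmod_verblunsky: "cmod (\<alpha> n) < 1"
proof -
  have "1 - (cmod (\<alpha> n))\<^sup>2 > 0"
    using \<kappa>_Suc[of n] \<kappa>_pos[of n] \<kappa>_pos[of "Suc n"] by (metis zero_less_mult_pos2)
  then show ?thesis by (simp add: abs_square_less_1)
qed


section \<open>Kernel polynomials at the point 1\<close>

lemma poly_monic_op_Suc_1: "poly (\<Phi> (Suc n)) 1 = poly (\<Phi> n) 1 - cnj (\<alpha> n * poly (\<Phi> n) 1)"
  by (simp add: szego poly_reciprocal_op_1)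

text \<open>At the point 1 the recurrence subtracts a number strictly smaller in modulus than
  \<open>poly (\<Phi> n) 1\<close>.\<close>

lemma poly_monic_op_1_nonzero: "poly (\<Phi> n) 1 \<noteq> 0"
proof (induction n)
  case (Suc n)
  have "cmod (cnj (\<alpha> n * poly (\<Phi> n) 1)) < cmod (poly (\<Phi> n) 1)"
    using Suc cmod_verblunsky[of n] by (simp add: norm_mult)
  then show ?case by (metis poly_monic_op_Suc_1 eq_iff_diff_eq_0 less_irrefl)
qed (simp add: monic_op_0)

section \<open>The coefficients g and c in terms of \<omega>\<close>

definition \<omega> :: "nat \<Rightarrow> complex" where
  "\<omega> n = op_rho M n * \<alpha> n"

lemma op_rho_eq: "op_rho M n = poly (\<Phi> n) 1 / cnj (poly (\<Phi> n) 1)"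
  by (simp add: op_rho_def poly_reciprocal_op_1)

lemma cmod_op_rho: "cmod (op_rho M n) = 1"
  using poly_monic_op_1_nonzero[of n] by (simp add: op_rho_eq norm_divide)

lemma cmod_\<omega>: "cmod (\<omega> n) = cmod (\<alpha> n)"
  by (simp add: \<omega>_def norm_mult cmod_op_rho)

lemma Re_\<omega>_less: "Re (\<omega> n) < 1"
  using complex_Re_le_cmod[of "\<omega> n"] cmod_verblunsky[of n] by (simp add: cmod_\<omega>)

lemma cnj_op_rho: "cnj (op_rho M n) = 1 / op_rho M n"
  by (simp add: op_rho_eq)

lemma op_rho_nonzero: "op_rho M n \<noteq> 0"
  using cmod_op_rho[of n] by auto

lemma verblunsky_mult_monic_op_1: "\<alpha> n * poly (\<Phi> n) 1 = \<omega> n * cnj (poly (\<Phi> n) 1)"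
  using poly_monic_op_1_nonzero[of n] by (simp add: \<omega>_def op_rho_eq)

lemma op_rho_Suc: "op_rho M (Suc n) = op_rho M n * (1 - cnj (\<omega> n)) / (1 - \<omega> n)"
proof -
  have "poly (\<Phi> (Suc n)) 1 = poly (\<Phi> n) 1 * (1 - cnj (\<omega> n))"
    by (simp add: poly_monic_op_Suc_1 verblunsky_mult_monic_op_1 algebra_simps)
  then show ?thesis by (simp add: op_rho_eq)
qed

abbreviation "\<gamma> \<equiv> kernel_g M"
abbreviation "\<eta> \<equiv> kernel_c M"

lemma kernel_c_Suc: "\<eta> (Suc n) = Im (\<omega> n) / (Re (\<omega> n) - 1)"
  by (simp add: kernel_c_def \<omega>_def)

text \<open>\<open>\<eta> (Suc n)\<close> is the tangent of the argument of
  \<open>1 - \<omega> n\<close>, whose real part is positive.\<close>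

lemma one_minus_\<omega>: "1 - \<omega> n = of_real (1 - Re (\<omega> n)) * (1 + \<i> * of_real (\<eta> (Suc n)))"
  using Re_\<omega>_less[of n] by (auto simp: kernel_c_Suc complex_eq_iff field_simps)

lemma one_minus_\<omega>_ratio:
  "(1 - cnj (\<omega> n)) / (1 - \<omega> n) = (1 - \<i> * of_real (\<eta> (Suc n))) / (1 + \<i> * of_real (\<eta> (Suc n)))"
  unfolding one_minus_\<omega>[of n, THEN arg_cong[of _ _ cnj], simplified]
  unfolding one_minus_\<omega>[of n] using Re_\<omega>_less[of n] by simp

lemma kernel_g_Suc: "\<gamma> (Suc n) = 1 / 2 * (1 - Re (\<omega> n)) * (1 + (\<eta> (Suc n))\<^sup>2)"
proof -
  have "(cmod (1 - \<omega> n))\<^sup>2 = (1 - Re (\<omega> n))\<^sup>2 * (1 + (\<eta> (Suc n))\<^sup>2)"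
    unfolding one_minus_\<omega> norm_mult by (simp add: power_mult_distrib cmod_power2)
  then show ?thesis using Re_\<omega>_less[of n]
    by (simp add: kernel_g_def \<omega>_def power2_eq_square)
qed

lemma kernel_g_pos: "\<gamma> (Suc n) > 0"
  using Re_\<omega>_less[of n] sum_power2_gt_zero_iff[of 1 "\<eta> (Suc n)"] by (simp add: kernel_g_Suc)

lemma \<omega>_eq: "\<omega> n = 1 - 2 * of_real (\<gamma> (Suc n)) / (1 - \<i> * of_real (\<eta> (Suc n)))"
proof -
  let ?c = "complex_of_real (\<eta> (Suc n))"
  have nz: "1 - \<i> * ?c \<noteq> 0" by (simp add: complex_eq_iff)
  have "2 * complex_of_real (\<gamma> (Suc n)) = of_real (1 - Re (\<omega> n)) * ((1 + \<i> * ?c) * (1 - \<i> * ?c))"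
    by (simp add: kernel_g_Suc algebra_simps power2_eq_square)
  then have "2 * of_real (\<gamma> (Suc n)) / (1 - \<i> * ?c) = 1 - \<omega> n"
    using nz by (simp add: one_minus_\<omega>)
  then show ?thesis by simp
qed

text \<open>Compute the squared modulus of \<open>1 - \<omega> n\<close> twice: from the definition
  of g, and by expansion using that \<omega> and \<alpha> have equal modulus. This converts the norm
  recursion into a product of factors 1 - g.\<close>

lemma one_minus_norm_verblunsky: "1 - (cmod (\<alpha> n))\<^sup>2 = 2 * (1 - Re (\<omega> n)) * (1 - \<gamma> (Suc n))"
proof -
  have "(cmod (1 - \<omega> n))\<^sup>2 = 2 * (1 - Re (\<omega> n)) * \<gamma> (Suc n)"
    using Re_\<omega>_less[of n] by (simp add: kernel_g_def \<omega>_def)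
  moreover have "(cmod (1 - \<omega> n))\<^sup>2 = 1 - 2 * Re (\<omega> n) + (cmod (\<omega> n))\<^sup>2"
    unfolding cmod_power2 by (simp add: power2_eq_square algebra_simps)
  ultimately show ?thesis by (simp add: cmod_\<omega> algebra_simps)
qed

text \<open>The product of the factors \<open>1 - Re (\<omega> k)\<close> occurs also in
  \<open>cnj_monic_op_1\<close>, so it cancels from the coefficients of the kernel
  polynomials.\<close>

lemma kernel_xi_eq: "2 ^ n * kernel_xi M n * (\<Prod>k<n. 1 - Re (\<omega> k)) = \<kappa> n"
proof (induction n)
  case 0
  show ?case by (simp add: kernel_xi_def \<kappa>_def monic_op_0)
next
  case (Suc n)
  have "2 ^ Suc n * kernel_xi M (Suc n) * (\<Prod>k<Suc n. 1 - Re (\<omega> k)) =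
     (2 ^ n * kernel_xi M n * (\<Prod>k<n. 1 - Re (\<omega> k))) * (2 * (1 - Re (\<omega> n)) * (1 - \<gamma> (Suc n)))"
    by (simp add: kernel_xi_def)
  also have "\<dots> = \<kappa> n * (1 - (cmod (\<alpha> n))\<^sup>2)"
    unfolding Suc one_minus_norm_verblunsky ..
  finally show ?case by (simp only: \<kappa>_Suc mult.commute)
qed

lemma cnj_monic_op_1: "cnj (poly (\<Phi> n) 1) =
    (\<Prod>k<n. of_real (1 - Re (\<omega> k))) * (\<Prod>k=1..n. 1 + \<i> * of_real (\<eta> k))"
proof (induction n)
  case 0
  show ?case by (simp add: monic_op_0)
next
  case (Suc n)
  have "cnj (poly (\<Phi> (Suc n)) 1) = cnj (poly (\<Phi> n) 1) * (1 - \<omega> n)"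
    by (simp add: poly_monic_op_Suc_1 verblunsky_mult_monic_op_1 algebra_simps)
  then show ?case unfolding Suc one_minus_\<omega> by simp
qed

section \<open>The kernel polynomials and their three term recurrence\<close>

lemma CD_kernel_eq: "CD_kernel M n z 1 =
    (\<Sum>j\<le>n. cnj (poly (\<Phi> j) 1) * poly (\<Phi> j) z / of_real (\<kappa> j))"
proof -
  have "complex_of_real (sqrt (\<kappa> j)) * of_real (sqrt (\<kappa> j)) = of_real (\<kappa> j)" for j
    using \<kappa>_pos[of j] by (simp flip: of_real_mult)
  then show ?thesis
    by (simp add: CD_kernel_def orthonormal_op_def flip: \<kappa>_def)
qed

lemma kernel_R_0: "kernel_R M 0 z = 1"
  using \<kappa>_pos[of 0] kernel_xi_eq[of 0] by (simp add: kernel_R_def CD_kernel_eq monic_op_0)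

text \<open>The kernel sum gains one term while its normalization changes by 2 (1 - g). The
  coefficient of the new term reduces to the product of the 1 + i c by \<open>kernel_xi_eq\<close>
  and \<open>cnj_monic_op_1\<close>.\<close>

lemma kernel_R_Suc: "kernel_R M (Suc n) z =
    2 * (1 - of_real (\<gamma> (Suc n))) * kernel_R M n z
    + (\<Prod>k=1..Suc n. 1 + \<i> * of_real (\<eta> k)) * poly (\<Phi> (Suc n)) z"
proof -
  let ?x = "\<lambda>n. complex_of_real (2 ^ n * kernel_xi M n)"
  let ?e = "\<Prod>k=1..Suc n. 1 + \<i> * of_real (\<eta> k)"
  let ?p = "\<Prod>k<Suc n. complex_of_real (1 - Re (\<omega> k))"
  have x: "?x (Suc n) * ?p = of_real (\<kappa> (Suc n))"
    unfolding kernel_xi_eq[symmetric] by simp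
  have "?x (Suc n) * cnj (poly (\<Phi> (Suc n)) 1) = (?x (Suc n) * ?p) * ?e"
    unfolding cnj_monic_op_1 by (simp only: mult.assoc)
  also have "\<dots> = of_real (\<kappa> (Suc n)) * ?e" by (simp only: x)
  finally have *: "?x (Suc n) * cnj (poly (\<Phi> (Suc n)) 1) / of_real (\<kappa> (Suc n)) = ?e"
    using \<kappa>_pos[of "Suc n"] by simp
  have xs: "?x (Suc n) = 2 * (1 - of_real (\<gamma> (Suc n))) * ?x n"
    by (simp add: kernel_xi_def)
  have R: "kernel_R M m z = ?x m * CD_kernel M m z 1" for m
    by (simp add: kernel_R_def)
  have "kernel_R M (Suc n) z = ?x (Suc n) * CD_kernel M n z 1
    + ?x (Suc n) * cnj (poly (\<Phi> (Suc n)) 1) / of_real (\<kappa> (Suc n)) * poly (\<Phi> (Suc n)) z"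
    unfolding R by (simp add: CD_kernel_eq algebra_simps)
  then show ?thesis unfolding * unfolding R xs by (simp add: mult.assoc)
qed

text \<open>Reversal with respect to degree n + 1 exchanges the two terms on the right of
  \<open>szego\<close>.\<close>

lemma poly_reciprocal_op_Suc: "poly (\<Phi>r (Suc n)) z = poly (\<Phi>r n) z - \<alpha> n * (z * poly (\<Phi> n) z)"
proof -
  have "\<Phi>r (Suc n) = \<Phi>r n - smult (\<alpha> n) (pCons 0 (\<Phi> n))"
  proof (rule poly_eqI)
    fix i
    show "coeff (\<Phi>r (Suc n)) i = coeff (\<Phi>r n - smult (\<alpha> n) (pCons 0 (\<Phi> n))) i"
    proof (cases "i \<le> n")
      case True
      then have "Suc n - i = Suc (n - i)" by simp
      with True show ?thesis
        by (cases i) (auto simp: coeff_reciprocal_op szego coeff_pCons degree_monic_op coeff_eq_0)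
    next
      case False
      then show ?thesis
        by (cases "i = Suc n")
          (auto simp: coeff_reciprocal_op szego coeff_pCons degree_monic_op coeff_eq_0
            lead_coeff_monic_op split: nat.split)
    qed
  qed
  then show ?thesis by simp
qed

lemma kernel_R_mult_z_minus_1: "(z - 1) * kernel_R M n z =
    (\<Prod>k=1..n. 1 + \<i> * of_real (\<eta> k)) * (z * poly (\<Phi> n) z - op_rho M n * poly (\<Phi>r n) z)"
proof (induction n)
  case 0
  show ?case by (simp add: kernel_R_0 monic_op_0 op_rho_eq reciprocal_op_def)
next
  case (Suc n)
  let ?e = "\<Prod>k=1..n. 1 + \<i> * of_real (\<eta> k)" and ?c = "complex_of_real (\<eta> (Suc n))"
  let ?g = "complex_of_real (\<gamma> (Suc n))"
  \<comment> \<open>Absorbing rho into the reversed polynomial turns the Verblunsky coefficient in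
    both Szego recurrences into \<omega>, hence into g and c.\<close>
  define X Y where "X = poly (\<Phi> n) z" and "Y = op_rho M n * poly (\<Phi>r n) z"
  have nz: "1 - \<i> * ?c \<noteq> 0" "1 + \<i> * ?c \<noteq> 0" by (simp_all add: complex_eq_iff)
  have r: "op_rho M n \<noteq> 0" by (rule op_rho_nonzero)
  have X: "poly (\<Phi> (Suc n)) z = z * X - cnj (\<omega> n) * Y"
    using r by (simp add: szego X_def Y_def \<omega>_def cnj_op_rho)
  have Y: "op_rho M (Suc n) * poly (\<Phi>r (Suc n)) z = (1 - cnj (\<omega> n)) / (1 - \<omega> n) * (Y - \<omega> n * z * X)"
  proof -
    have "op_rho M n * poly (\<Phi>r (Suc n)) z = Y - \<omega> n * z * X"
      by (simp add: poly_reciprocal_op_Suc X_def Y_def \<omega>_def algebra_simps)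
    then show ?thesis by (simp add: op_rho_Suc mult.commute)
  qed
  have wc: "(1 + \<i> * ?c) * cnj (\<omega> n) = 1 + \<i> * ?c - 2 * ?g"
    using nz by (simp add: \<omega>_eq field_simps)
  have w': "(1 - \<i> * ?c) * \<omega> n = 1 - \<i> * ?c - 2 * ?g"
    using nz by (simp add: \<omega>_eq field_simps)
  have "(1 + \<i> * ?c) * (z * poly (\<Phi> (Suc n)) z - op_rho M (Suc n) * poly (\<Phi>r (Suc n)) z)
     = z * ((1 + \<i> * ?c) * z * X - (1 + \<i> * ?c) * cnj (\<omega> n) * Y)
       - ((1 - \<i> * ?c) * Y - (1 - \<i> * ?c) * \<omega> n * z * X)"
    unfolding X Y one_minus_\<omega>_ratio using nz by (simp add: field_simps)
  also have "\<dots> = 2 * (1 - ?g) * (z * X - Y) + (z - 1) * ((1 + \<i> * ?c) * z * X - (1 + \<i> * ?c) * cnj (\<omega> n) * Y)"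
    unfolding w' wc by (simp add: algebra_simps)
  also have "\<dots> = 2 * (1 - ?g) * (z * X - Y) + (z - 1) * (1 + \<i> * ?c) * poly (\<Phi> (Suc n)) z"
    unfolding X by (simp add: algebra_simps)
  finally have main: "(1 + \<i> * ?c) * (z * poly (\<Phi> (Suc n)) z - op_rho M (Suc n) * poly (\<Phi>r (Suc n)) z)
     = 2 * (1 - ?g) * (z * X - Y) + (z - 1) * (1 + \<i> * ?c) * poly (\<Phi> (Suc n)) z" .
  have "(z - 1) * kernel_R M (Suc n) z = 2 * (1 - ?g) * ((z - 1) * kernel_R M n z)
      + (z - 1) * (?e * (1 + \<i> * ?c)) * poly (\<Phi> (Suc n)) z"
    by (simp add: kernel_R_Suc algebra_simps)
  also have "\<dots> = ?e * (2 * (1 - ?g) * (z * X - Y) + (z - 1) * (1 + \<i> * ?c) * poly (\<Phi> (Suc n)) z)"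
    unfolding Suc X_def Y_def by (simp add: algebra_simps)
  finally show ?case unfolding main [symmetric] by simp
qed

text \<open>Christoffel-Darboux eliminates the reversed polynomial from \<open>kernel_R_Suc\<close>.
  The last bracket vanishes for n = 0, and for n > 0 it is 2 (1 - g_n) R_{n-1} by
  \<open>kernel_R_Suc\<close> at the previous index.\<close>

lemma kernel_R_step: "kernel_R M (Suc n) z =
    ((1 + \<i> * of_real (\<eta> (Suc n))) * z + (1 - \<i> * of_real (\<eta> (Suc n)))) * kernel_R M n z
    - 2 * of_real (\<gamma> (Suc n)) * z * (kernel_R M n z - (\<Prod>k=1..n. 1 + \<i> * of_real (\<eta> k)) * poly (\<Phi> n) z)"
proof -
  let ?e = "\<Prod>k=1..n. 1 + \<i> * of_real (\<eta> k)" and ?c = "complex_of_real (\<eta> (Suc n))"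
  let ?g = "complex_of_real (\<gamma> (Suc n))"
  define X Y where "X = poly (\<Phi> n) z" and "Y = op_rho M n * poly (\<Phi>r n) z"
  have nz: "1 - \<i> * ?c \<noteq> 0" "1 + \<i> * ?c \<noteq> 0" by (simp_all add: complex_eq_iff)
  have r: "op_rho M n \<noteq> 0" by (rule op_rho_nonzero)
  have X: "poly (\<Phi> (Suc n)) z = z * X - cnj (\<omega> n) * Y"
    using r by (simp add: szego X_def Y_def \<omega>_def cnj_op_rho)
  have wc: "(1 + \<i> * ?c) * cnj (\<omega> n) = 1 + \<i> * ?c - 2 * ?g"
    using nz by (simp add: \<omega>_eq field_simps)
  have R: "z * kernel_R M n z - kernel_R M n z = ?e * (z * X - Y)"
    using kernel_R_mult_z_minus_1[of z n] by (simp add: X_def Y_def algebra_simps)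
  have "(1 + \<i> * ?c) * poly (\<Phi> (Suc n)) z = (1 + \<i> * ?c) * z * X - (1 + \<i> * ?c) * cnj (\<omega> n) * Y"
    by (simp add: X algebra_simps)
  then have P: "(1 + \<i> * ?c) * poly (\<Phi> (Suc n)) z = (1 + \<i> * ?c - 2 * ?g) * (z * X - Y) + 2 * ?g * z * X"
    unfolding wc by (simp add: algebra_simps)
  have "kernel_R M (Suc n) z = 2 * (1 - ?g) * kernel_R M n z + ?e * ((1 + \<i> * ?c) * poly (\<Phi> (Suc n)) z)"
    by (simp add: kernel_R_Suc)
  also have "\<dots> = 2 * (1 - ?g) * kernel_R M n z + (1 + \<i> * ?c - 2 * ?g) * (?e * (z * X - Y)) + ?e * 2 * ?g * z * X"
    unfolding P by (simp add: algebra_simps)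
  finally show ?thesis
    unfolding R [symmetric] unfolding X_def by (simp add: algebra_simps)
qed

lemma kernel_R_1: "kernel_R M 1 z =
    (1 + \<i> * of_real (\<eta> 1)) * z + (1 - \<i> * of_real (\<eta> 1))"
  using kernel_R_step[of 0 z] by (simp add: kernel_R_0 monic_op_0)

lemma kernel_R_recurrence:
  assumes "n \<ge> 1"
  shows "kernel_R M (n + 1) z =
    ((1 + \<i> * of_real (\<eta> (n + 1))) * z + (1 - \<i> * of_real (\<eta> (n + 1)))) * kernel_R M n z
    - 4 * of_real (kernel_d M (n + 1)) * z * kernel_R M (n - 1) z"
proof -
  obtain m where n: "n = Suc m" using assms by (cases n) auto
  have "kernel_R M n z - (\<Prod>k=1..n. 1 + \<i> * of_real (\<eta> k)) * poly (\<Phi> n) z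
      = 2 * (1 - of_real (\<gamma> n)) * kernel_R M (n - 1) z"
    unfolding n by (simp add: kernel_R_Suc)
  then show ?thesis
    using kernel_R_step[of n z] by (simp add: kernel_d_def)
qed

end


section \<open>Derivatives of moments and orthogonal polynomials\<close>

text \<open>From (1 - x) exp x <= 1 one gets (1 - x) (exp x - 1 - x) <= x^2, and 1 - x is at least
  1/2. This controls the remainder when differentiating under the integral.\<close>

lemma exp_minus_one_minus_self_bound:
  fixes x :: real
  assumes "\<bar>x\<bar> \<le> 1/2"
  shows "\<bar>exp x - 1 - x\<bar> \<le> 2 * x\<^sup>2"
proof -
  have "(1 - x) * exp x \<le> exp (- x) * exp x"
    using exp_ge_add_one_self[of "- x"] by (intro mult_right_mono) auto
  then have "(1 - x) * exp x \<le> 1" by (simp flip: exp_add)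
  then have "(1 - x) * (exp x - 1 - x) \<le> x\<^sup>2"
    by (simp add: algebra_simps power2_eq_square)
  moreover have nonneg: "exp x - 1 - x \<ge> 0" using exp_ge_add_one_self[of x] by linarith
  moreover have "1/2 * (exp x - 1 - x) \<le> (1 - x) * (exp x - 1 - x)"
    using assms nonneg by (intro mult_right_mono) auto
  ultimately show ?thesis by simp
qed

lemma poly_eq_sum_atMost:
  fixes p :: "'a::comm_semiring_1 poly"
  assumes "degree p \<le> n"
  shows "poly p z = (\<Sum>i\<le>n. coeff p i * z ^ i)"
  unfolding poly_altdef
proof (rule sum.mono_neutral_left)
  show "\<forall>i\<in>{..n} - {..degree p}. coeff p i * z ^ i = 0" by (simp add: coeff_eq_0)
qed (use assms in auto)

section \<open>The deformed measures\<close>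

locale circle_deformation = circle_measure +
  fixes q :: complex
begin

text \<open>The exponent conj(q) z + q/z of the weight, which is real on the circle.\<close>

definition v :: "complex \<Rightarrow> real" where
  "v z = 2 * Re (cnj q * z)"

lemma of_real_v: "z \<in> space M \<Longrightarrow> complex_of_real (v z) = cnj q * z + q * cnj z"
  by (simp add: v_def complex_eq_iff)

lemma continuous_v [continuous_intros]: "continuous_on A v"
  unfolding v_def by (intro continuous_intros)

lemma weight_eq:
  assumes "z \<in> space M"
  shows "Re (exp (- of_real t * (cnj q * z + q / z))) = exp (- t * v z)"
proof -
  have "- of_real t * (cnj q * z + q / z) = complex_of_real (- t * v z)"
    using assms by (simp add: of_real_v cnj_eq_inverse field_simps)
  then show ?thesis by (simp only: Re_exp Re_complex_of_real Im_complex_of_real) simp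
qed

abbreviation "N \<equiv> deformed_measure M q"

lemma deformed_measure_eq: "N t = density M (\<lambda>z. ennreal (exp (- t * v z)))"
proof -
  have m: "(\<lambda>z. ennreal (exp (- t * v z))) \<in> borel_measurable M"
    by (intro measurable_compose[OF borel_measurable_continuous measurable_ennreal] continuous_intros)
  have "(\<lambda>z. ennreal (Re (exp (- of_real t * (cnj q * z + q / z))))) \<in> borel_measurable M
      \<longleftrightarrow> (\<lambda>z. ennreal (exp (- t * v z))) \<in> borel_measurable M"
    by (rule measurable_cong) (simp only: weight_eq)
  then show ?thesis
    unfolding deformed_measure_def using m
    by (intro density_cong AE_I2) (simp_all only: weight_eq)
qed

lemma sets_deformed [simp]: "sets (N t) = sets M" and space_deformed [simp]: "space (N t) = space M"
  by (simp_all add: deformed_measure_def)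

lemma measurable_weight [measurable]: "(\<lambda>z. exp (- t * v z)) \<in> borel_measurable M"
  by (intro borel_measurable_continuous continuous_intros)

text \<open>The weight is continuous on a compact set, which gives finiteness, and strictly
  positive, so an open set that is null for the density is null for M and the support does not
  shrink.\<close>

lemma circle_measure_deformed: "circle_measure (N t)"
proof
  have "integrable M (\<lambda>z. exp (- t * v z))"
    by (intro integrable_continuous continuous_intros)
  then have "emeasure (N t) (space (N t)) \<noteq> \<infinity>"
    using measurable_weight[of t]
    by (simp add: deformed_measure_eq emeasure_density cong: nn_integral_cong)
      (simp add: nn_integral_eq_integral)
  then have "finite_measure (N t)" by (rule finite_measureI)
  then show "unit_circle_measure (N t)"
    using sets_eq by (simp add: unit_circle_measure_def)
  have "measure_support M \<subseteq> measure_support (N t)"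
  proof
    fix z assume z: "z \<in> measure_support M"
    have "emeasure (N t) (U \<inter> space M) > 0" if U: "open U" "z \<in> U" for U
    proof (rule ccontr)
      assume "\<not> ?thesis"
      moreover have S: "U \<inter> space M \<in> sets M"
        using U(1) by (rule open_Int_space)
      ultimately have "U \<inter> space M \<in> null_sets (N t)" by (simp add: null_sets_def)
      then have "AE z in M. z \<in> U \<inter> space M \<longrightarrow> ennreal (exp (- t * v z)) = 0"
        unfolding deformed_measure_eq
        using measurable_weight[of t] by (auto simp: null_sets_density_iff)
      then have "AE z in M. z \<notin> U \<inter> space M"
        by eventually_elim auto
      then have "emeasure M (U \<inter> space M) = 0"
        using S by (simp add: AE_iff_null_sets null_setsD1)
      then show False using z U by (auto simp: measure_support_def)
    qed
    then show "z \<in> measure_support (N t)" using z by (auto simp: measure_support_def)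
  qed
  then show "infinite (measure_support (N t))"
    using infinite_support finite_subset by blast
qed

sublocale N: circle_measure "N t" for t
  by (rule circle_measure_deformed)

section \<open>Differentiation under the integral sign\<close>

lemma integral_deformed:
  fixes f :: "complex \<Rightarrow> complex"
  assumes "continuous_on (sphere 0 1) f"
  shows "(LINT z|N t. f z) = (LINT z|M. exp (- t * v z) *\<^sub>R f z)"
  unfolding deformed_measure_eq
  by (rule integral_density[OF borel_measurable_continuous[OF assms] measurable_weight]) simp

text \<open>Factor the weight at s as exp (-(s - t) v) times the weight at t. As v is bounded on the
  circle, the remainder of first order is O((s - t)^2) uniformly in z.\<close>

lemma has_vector_derivative_integral_deformed:
  fixes f :: "complex \<Rightarrow> complex"
  assumes f: "continuous_on (sphere 0 1) f"
  shows "((\<lambda>s. LINT z|N s. f z) has_vector_derivative - (LINT z|N t. v z *\<^sub>R f z)) (at t)"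
proof -
  have "compact (v ` sphere 0 1)" "compact ((\<lambda>z. exp (- t * v z) *\<^sub>R f z) ` sphere 0 1)"
    using f by (intro compact_continuous_image continuous_intros; simp)+
  then obtain B K where "\<And>z. z \<in> sphere 0 1 \<Longrightarrow> norm (v z) \<le> B"
    and K: "\<And>z. z \<in> sphere 0 1 \<Longrightarrow> norm (exp (- t * v z) *\<^sub>R f z) \<le> K"
    unfolding compact_eq_bounded_closed bounded_iff by (metis imageI)
  then have B: "\<And>z. z \<in> sphere 0 1 \<Longrightarrow> \<bar>v z\<bar> \<le> \<bar>B\<bar> + 1"
    by fastforce
  \<comment> \<open>Adding 1 keeps b positive; for s within 1 / (2 b) of t the exponent stays in
    [-1/2, 1/2], as the exponential estimate requires.\<close>
  define b where "b = \<bar>B\<bar> + 1"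
  define m where "m = measure M (space M)"
  let ?D = "- (LINT z|N t. v z *\<^sub>R f z)"
  have b: "b > 0" by (simp add: b_def)
  have bound: "norm ((LINT z|N s. f z) - (LINT z|N t. f z) - (s - t) *\<^sub>R ?D)
      \<le> (K * (2 * (b * (s - t))\<^sup>2)) * m" if s: "dist s t < 1 / (2 * b)" for s
  proof -
    let ?x = "\<lambda>z. - (s - t) * v z"
    have int: "integrable M (\<lambda>z. exp (- s * v z) *\<^sub>R f z)" "integrable M (\<lambda>z. exp (- t * v z) *\<^sub>R f z)"
      "integrable M (\<lambda>z. (s - t) *\<^sub>R (exp (- t * v z) *\<^sub>R (v z *\<^sub>R f z)))"
      using f by (intro integrable_continuous continuous_intros; simp)+
    let ?G = "\<lambda>z. (exp (?x z) - 1 - ?x z) *\<^sub>R (exp (- t * v z) *\<^sub>R f z)"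
    have "(LINT z|N s. f z) - (LINT z|N t. f z) - (s - t) *\<^sub>R ?D
      = (LINT z|M. exp (- s * v z) *\<^sub>R f z - exp (- t * v z) *\<^sub>R f z
           + (s - t) *\<^sub>R (exp (- t * v z) *\<^sub>R (v z *\<^sub>R f z)))"
      using int f by (simp add: integral_deformed continuous_intros del: scaleR_scaleR)
    also have "\<dots> = (LINT z|M. (exp (?x z) - 1 - ?x z) *\<^sub>R (exp (- t * v z) *\<^sub>R f z))"
    proof (rule Bochner_Integration.integral_cong)
      fix z
      have "exp (- s * v z) = exp (?x z) * exp (- t * v z)"
        by (simp add: algebra_simps flip: exp_add)
      then show "exp (- s * v z) *\<^sub>R f z - exp (- t * v z) *\<^sub>R f z
           + (s - t) *\<^sub>R (exp (- t * v z) *\<^sub>R (v z *\<^sub>R f z))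
         = (exp (?x z) - 1 - ?x z) *\<^sub>R (exp (- t * v z) *\<^sub>R f z)"
        by (simp add: algebra_simps)
    qed simp
    finally have "norm ((LINT z|N s. f z) - (LINT z|N t. f z) - (s - t) *\<^sub>R ?D) = norm (LINT z|M. ?G z)"
      by (rule arg_cong)
    moreover have "norm (LINT z|M. ?G z) \<le> (LINT z|M. norm (?G z))"
      by (rule integral_norm_bound)
    moreover have "(LINT z|M. norm (?G z)) \<le> (LINT z|M. K * (2 * (b * (s - t))\<^sup>2))"
    proof (rule integral_mono)
      show "integrable M (\<lambda>z. norm ((exp (?x z) - 1 - ?x z) *\<^sub>R (exp (- t * v z) *\<^sub>R f z)))"
        using f by (intro integrable_continuous continuous_intros; simp)
      fix z assume z: "z \<in> space M"
      then have vz: "\<bar>v z\<bar> \<le> b" using B unfolding space_eq b_def by blast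
      have x: "\<bar>?x z\<bar> \<le> b * \<bar>s - t\<bar>"
        using mult_right_mono[OF vz, of "\<bar>s - t\<bar>"] by (simp add: abs_mult mult.commute abs_minus_commute)
      also have "\<dots> \<le> 1/2" using s b by (simp add: dist_real_def field_simps)
      finally have "\<bar>exp (?x z) - 1 - ?x z\<bar> \<le> 2 * (?x z)\<^sup>2"
        by (rule exp_minus_one_minus_self_bound)
      also have "\<dots> \<le> 2 * (b * (s - t))\<^sup>2"
        using x b by (simp add: abs_le_square_iff[symmetric] abs_mult)
      finally have "\<bar>exp (?x z) - 1 - ?x z\<bar> * norm (exp (- t * v z) *\<^sub>R f z) \<le> 2 * (b * (s - t))\<^sup>2 * K"
        using K z by (intro mult_mono) (auto simp: space_eq)
      then show "norm ((exp (?x z) - 1 - ?x z) *\<^sub>R (exp (- t * v z) *\<^sub>R f z)) \<le> K * (2 * (b * (s - t))\<^sup>2)"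
        unfolding norm_scaleR[of "exp (?x z) - 1 - ?x z"] by (simp only: mult.commute)
    qed simp
    moreover have "(LINT z|M. K * (2 * (b * (s - t))\<^sup>2)) = (K * (2 * (b * (s - t))\<^sup>2)) * m"
      by (simp add: m_def)
    ultimately show ?thesis by linarith
  qed
  show ?thesis
    unfolding has_vector_derivative_def
  proof (rule has_derivativeI_sandwich[where e = "1 / (2 * b)" and H = "\<lambda>s. 2 * K * b\<^sup>2 * m * \<bar>s - t\<bar>"])
    show "0 < 1 / (2 * b)" using b by simp
    show "bounded_linear (\<lambda>x. x *\<^sub>R ?D)" by (rule bounded_linear_scaleR_left)
    show "((\<lambda>s. 2 * K * b\<^sup>2 * m * \<bar>s - t\<bar>) \<longlongrightarrow> 0) (at t)"
      by (auto intro!: tendsto_eq_intros)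
    fix s assume s: "s \<noteq> t" "dist s t < 1 / (2 * b)"
    have eq: "(K * (2 * (b * (s - t))\<^sup>2)) * m = 2 * K * b\<^sup>2 * m * \<bar>s - t\<bar> * norm (s - t)"
      by (simp add: power_mult_distrib power2_eq_square)
    show "norm ((LINT z|N s. f z) - (LINT z|N t. f z) - (s - t) *\<^sub>R ?D) / norm (s - t)
        \<le> 2 * K * b\<^sup>2 * m * \<bar>s - t\<bar>"
      using bound[OF s(2)] s(1) unfolding eq by (intro mult_imp_div_pos_le) simp_all
  qed
qed

lemma v_mult_integral:
  "(LINT z|N t. v z *\<^sub>R (poly p z * cnj (z ^ k))) = cnj q * N.mom t (pCons 0 p) k + q * N.mom t p (Suc k)"
proof -
  have "(LINT z|N t. v z *\<^sub>R (poly p z * cnj (z ^ k))) =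
      (LINT z|N t. cnj q * (poly (pCons 0 p) z * cnj (z ^ k)) + q * (poly p z * cnj (z ^ Suc k)))"
    by (rule Bochner_Integration.integral_cong)
      (simp_all add: scaleR_conv_of_real of_real_v algebra_simps)
  also have "\<dots> = cnj q * N.mom t (pCons 0 p) k + q * N.mom t p (Suc k)"
    unfolding N.mom_def
    by (subst Bochner_Integration.integral_add)
      (intro integrable_mult_right N.integrable_mom, intro integrable_mult_right N.integrable_mom,
        simp only: integral_mult_right_zero)
  finally show ?thesis .
qed

text \<open>Product rule on the coefficient expansion: \<open>p'\<close> comes from the
  coefficients, the subtracted terms from the weight via \<open>v_mult_integral\<close>. A degree
  bound uniform in s keeps the range of summation fixed.\<close>

lemma has_vector_derivative_mom:
  assumes deg: "\<And>s. degree (p s) \<le> n" "degree p' \<le> n"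
    and p: "\<And>i. ((\<lambda>s. coeff (p s) i) has_vector_derivative coeff p' i) (at t)"
  shows "((\<lambda>s. N.mom s (p s) k) has_vector_derivative
      N.mom t p' k - (cnj q * N.mom t (pCons 0 (p t)) k + q * N.mom t (p t) (Suc k))) (at t)"
proof -
  let ?f = "\<lambda>i z. z ^ i * cnj (z ^ k) :: complex"
  have cont [continuous_intros]: "continuous_on A (?f i)" for A i
    by (intro continuous_intros)
  have int: "integrable (N s) (\<lambda>z. coeff r i * ?f i z)" "integrable (N s) (\<lambda>z. coeff r i * (v z *\<^sub>R ?f i z))" for s r i
    by (intro N.integrable_continuous continuous_intros)+
  have mom: "N.mom s r k = (\<Sum>i\<le>n. coeff r i * (LINT z|N s. ?f i z))" if "degree r \<le> n" for r s
    unfolding N.mom_def using int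
    by (simp add: poly_eq_sum_atMost[OF that] sum_distrib_right mult.assoc Bochner_Integration.integral_sum
        del: complex_cnj_power)
  have vint: "(\<Sum>i\<le>n. coeff (p t) i * (LINT z|N t. v z *\<^sub>R ?f i z))
     = cnj q * N.mom t (pCons 0 (p t)) k + q * N.mom t (p t) (Suc k)"
  proof -
    have "(\<Sum>i\<le>n. coeff (p t) i * (LINT z|N t. v z *\<^sub>R ?f i z))
      = (LINT z|N t. (\<Sum>i\<le>n. coeff (p t) i * (v z *\<^sub>R ?f i z)))"
      by (simp only: Bochner_Integration.integral_sum[OF int(2)] integral_mult_right_zero)
    also have "\<dots> = (LINT z|N t. v z *\<^sub>R (poly (p t) z * cnj (z ^ k)))"
      by (simp add: poly_eq_sum_atMost[OF deg(1)] sum_distrib_right scaleR_sum_right mult.assoc)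
    finally show ?thesis unfolding v_mult_integral .
  qed
  have "((\<lambda>s. \<Sum>i\<le>n. coeff (p s) i * (LINT z|N s. ?f i z)) has_vector_derivative
      (\<Sum>i\<le>n. coeff (p t) i * - (LINT z|N t. v z *\<^sub>R ?f i z) + coeff p' i * (LINT z|N t. ?f i z))) (at t)"
    by (intro has_vector_derivative_sum has_vector_derivative_mult p
        has_vector_derivative_integral_deformed cont)
  also have "(\<Sum>i\<le>n. coeff (p t) i * - (LINT z|N t. v z *\<^sub>R ?f i z) + coeff p' i * (LINT z|N t. ?f i z))
     = N.mom t p' k - (\<Sum>i\<le>n. coeff (p t) i * (LINT z|N t. v z *\<^sub>R ?f i z))"
    by (simp only: mom[OF deg(2)] sum.distrib) (simp add: sum_negf)
  finally show ?thesis unfolding vint mom[OF deg(1), symmetric] .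
qed

lemma polynomial_derivative_exists:
  assumes deg: "\<And>s. degree (p s) \<le> n"
    and p: "\<And>i. (\<lambda>s. coeff (p s) i) differentiable (at t)"
  obtains p' where "degree p' \<le> n" "\<And>i. ((\<lambda>s. coeff (p s) i) has_vector_derivative coeff p' i) (at t)"
proof
  let ?p' = "\<Sum>i\<le>n. monom (vector_derivative (\<lambda>s. coeff (p s) i) (at t)) i"
  have c: "coeff ?p' i = (if i \<le> n then vector_derivative (\<lambda>s. coeff (p s) i) (at t) else 0)" for i
    by (simp add: coeff_sum if_distrib cong: if_cong)
  show "degree ?p' \<le> n" by (rule degree_le) (use c in auto)
  fix i
  show "((\<lambda>s. coeff (p s) i) has_vector_derivative coeff ?p' i) (at t)"
  proof (cases "i \<le> n")
    case True
    then show ?thesis unfolding c using p[of i] by (simp flip: vector_derivative_works)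
  next
    case False
    then have "(\<lambda>s. coeff (p s) i) = (\<lambda>s. 0)"
      by (intro ext coeff_eq_0 le_less_trans[OF deg]) simp
    then show ?thesis unfolding c using False by simp
  qed
qed

section \<open>Differentiability and derivative of the orthogonal polynomials\<close>

lemma differentiable_mom:
  assumes "\<And>s. degree (p s) \<le> n" "\<And>i. (\<lambda>s. coeff (p s) i) differentiable (at t)"
  shows "(\<lambda>s. N.mom s (p s) k) differentiable (at t)"
proof -
  obtain p' where "degree p' \<le> n" "\<And>i. ((\<lambda>s. coeff (p s) i) has_vector_derivative coeff p' i) (at t)"
    by (rule polynomial_derivative_exists[OF assms]) (assumption | rule that)+
  then show ?thesis
    by (intro differentiableI_vector[OF has_vector_derivative_mom[OF assms(1)]])
qed

lemma differentiable_cnj: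
  fixes f :: "real \<Rightarrow> complex"
  shows "f differentiable (at t) \<Longrightarrow> (\<lambda>s. cnj (f s)) differentiable (at t)"
  using has_vector_derivative_cnj differentiableI_vector vector_derivative_works by blast

text \<open>Induction along the Szego recurrence, whose coefficient is a quotient of differentiable
  moments with nonzero denominator.\<close>

lemma differentiable_coeff_monic_op: "(\<lambda>s. coeff (N.\<Phi> s n) i) differentiable (at t)"
proof (induction n arbitrary: i)
  case 0
  show ?case by (simp add: N.monic_op_0)
next
  case (Suc n)
  have 1: "(\<lambda>s. coeff (pCons 0 (N.\<Phi> s n)) i) differentiable (at t)" for i
    using Suc by (cases i) simp_all
  have "(\<lambda>s. N.mom s (pCons 0 (N.\<Phi> s n)) 0) differentiable (at t)"
    by (rule differentiable_mom[OF _ 1, of "Suc n"]) (simp add: degree_pCons_le N.degree_monic_op)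
  moreover have "(\<lambda>s. N.mom s (N.\<Phi> s n) n) differentiable (at t)"
    by (rule differentiable_mom[OF _ Suc, of n]) (simp add: N.degree_monic_op)
  moreover have "(\<lambda>s. coeff (N.\<Phi>r s n) i) differentiable (at t)"
    using differentiable_cnj[OF Suc] by (cases "i \<le> n") (simp_all add: N.coeff_reciprocal_op)
  moreover have "N.mom t (N.\<Phi> t n) n \<noteq> 0"
    using N.\<kappa>_pos[of t n] by (simp add: N.mom_monic_op_self)
  ultimately have "(\<lambda>s. coeff (pCons 0 (N.\<Phi> s n)) i
      - N.mom s (pCons 0 (N.\<Phi> s n)) 0 / N.mom s (N.\<Phi> s n) n * coeff (N.\<Phi>r s n) i) differentiable (at t)"
    by (intro differentiable_diff differentiable_mult differentiable_divide 1)
  then show ?case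
    by (simp only: N.szego N.cnj_verblunsky N.mom_monic_op_self coeff_diff coeff_smult)
qed

text \<open>The leading coefficient is constant, so the derivative has degree at most n and is
  determined by its inner products with 1, ..., z^n. Differentiating the orthogonality relations
  shows that only those with k = 0 and k = n can be nonzero; the reversed polynomial accounts for
  the former and \<open>\<Phi>\<close> for the latter. The factor in front converts
  \<open>\<kappa>\<close> at n into \<open>\<kappa>\<close> at n + 1.\<close>

lemma has_vector_derivative_monic_op:
  "((\<lambda>s. poly (N.\<Phi> s (Suc n)) z) has_vector_derivative
     of_real (1 - (cmod (N.\<alpha> t n))\<^sup>2) *
      (q * poly (N.\<Phi> t n) z + cnj q * cnj (N.\<alpha> t (Suc n)) * poly (N.\<Phi>r t n) z)) (at t)"
proof -
  obtain p' where deg: "degree p' \<le> Suc n"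
    and p': "\<And>i. ((\<lambda>s. coeff (N.\<Phi> s (Suc n)) i) has_vector_derivative coeff p' i) (at t)"
    by (rule polynomial_derivative_exists[of "\<lambda>s. N.\<Phi> s (Suc n)" "Suc n" t])
      (simp_all add: N.degree_monic_op differentiable_coeff_monic_op)
  let ?k = "complex_of_real (1 - (cmod (N.\<alpha> t n))\<^sup>2)"
  let ?r = "smult ?k (smult q (N.\<Phi> t n) + smult (cnj q * cnj (N.\<alpha> t (Suc n))) (N.\<Phi>r t n))"
  have "coeff p' (Suc n) = 0"
  proof (rule vector_derivative_unique_at)
    show "((\<lambda>s. coeff (N.\<Phi> s (Suc n)) (Suc n)) has_vector_derivative coeff p' (Suc n)) (at t)"
      by (rule p')
    show "((\<lambda>s. coeff (N.\<Phi> s (Suc n)) (Suc n)) has_vector_derivative 0) (at t)"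
      by (simp add: N.lead_coeff_monic_op)
  qed
  then have "coeff p' i = 0" if "i > n" for i
    using that deg by (cases "i = Suc n") (auto simp: coeff_eq_0)
  then have "degree p' \<le> n" by (auto intro: degree_le)
  moreover have "degree ?r \<le> n"
    by (intro degree_smult_le[THEN order.trans] degree_add_le)
      (simp_all add: N.degree_monic_op N.degree_reciprocal_op)
  ultimately have d: "degree (p' - ?r) < Suc n" using degree_diff_le[of p' n ?r] by simp
  have \<kappa>: "?k * of_real (N.\<kappa> t n) = of_real (N.\<kappa> t (Suc n))"
    by (simp add: N.\<kappa>_Suc)
  have "N.mom t (p' - ?r) k = 0" if k: "k < Suc n" for k
  proof -
    have "N.mom t p' k - (cnj q * N.mom t (pCons 0 (N.\<Phi> t (Suc n))) k + q * N.mom t (N.\<Phi> t (Suc n)) (Suc k)) = 0"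
    proof (rule vector_derivative_unique_at)
      show "((\<lambda>s. N.mom s (N.\<Phi> s (Suc n)) k) has_vector_derivative
        N.mom t p' k - (cnj q * N.mom t (pCons 0 (N.\<Phi> t (Suc n))) k + q * N.mom t (N.\<Phi> t (Suc n)) (Suc k))) (at t)"
        by (rule has_vector_derivative_mom[OF _ deg p']) (simp add: N.degree_monic_op)
      show "((\<lambda>s. N.mom s (N.\<Phi> s (Suc n)) k) has_vector_derivative 0) (at t)"
        using k by (simp add: N.mom_monic_op)
    qed
    then have p'k: "N.mom t p' k = cnj q * (if k = 0 then cnj (N.\<alpha> t (Suc n)) * of_real (N.\<kappa> t (Suc n)) else 0)
        + q * (if k = n then of_real (N.\<kappa> t (Suc n)) else 0)"
      using k by (simp add: N.mom_pCons_monic_op N.mom_monic_op N.mom_monic_op_self)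
    have rk: "N.mom t ?r k = ?k * (q * (if k = n then of_real (N.\<kappa> t n) else 0)
        + cnj q * cnj (N.\<alpha> t (Suc n)) * (if k = 0 then of_real (N.\<kappa> t n) else 0))"
      using k by (simp add: N.mom_smult N.mom_add N.mom_reciprocal_op N.mom_monic_op N.mom_monic_op_self)
    show ?thesis
      unfolding N.mom_diff p'k rk \<kappa>[symmetric] by (simp add: algebra_simps)
  qed
  then have "p' - ?r = 0" using N.eq_0_if_orthogonal d by blast
  then have "p' = ?r" by simp
  have "((\<lambda>s. \<Sum>i\<le>Suc n. coeff (N.\<Phi> s (Suc n)) i * z ^ i) has_vector_derivative
      (\<Sum>i\<le>Suc n. coeff p' i * z ^ i)) (at t)"
    by (intro has_vector_derivative_sum has_vector_derivative_mult_left p')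
  then have "((\<lambda>s. poly (N.\<Phi> s (Suc n)) z) has_vector_derivative poly p' z) (at t)"
    by (simp only: poly_eq_sum_atMost[OF deg] poly_eq_sum_atMost[of "N.\<Phi> _ (Suc n)" "Suc n"] N.degree_monic_op order.refl)
  then show ?thesis unfolding \<open>p' = ?r\<close> by simp
qed

end


section \<open>The flow of the recurrence coefficients\<close>

lemma has_vector_derivative_quotient:
  fixes f g :: "real \<Rightarrow> 'a::real_normed_field"
  assumes "(f has_vector_derivative f') (at t)" "(g has_vector_derivative g') (at t)" "g t \<noteq> 0"
  shows "((\<lambda>s. f s / g s) has_vector_derivative (f' * g t - f t * g') / (g t * g t)) (at t)"
  using has_derivative_divide'[OF assms[unfolded has_vector_derivative_def]]
  by (simp add: has_vector_derivative_def divide_inverse flip: scaleR_diff_right)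

text \<open>Here \<open>w\<close>, \<open>e\<close>, \<open>E\<close>, \<open>g\<close> stand for \<open>w_n\<close>, \<open>1 + i c_{n+1}\<close>, its conjugate and \<open>g_{n+1}\<close>; \<open>Q\<close>, \<open>X\<close>, \<open>Y\<close> are the
  conjugates of \<open>q\<close>, \<open>x = (1 - g_n) / (1 + i c_n)\<close> and \<open>y = g_{n+2} / (1 - i c_{n+2})\<close>, \<open>G\<close> is the
  derivative of \<open>g_{n+1}\<close> and \<open>C\<close> is \<open>i\<close> times that of \<open>c_{n+1}\<close>.\<close>

lemma flow_identity:
  fixes q Q x X y Y e E g w :: complex
  assumes "e + E = 2" "e \<noteq> 0" "E \<noteq> 0" "w = 1 - 2 * g / E"
  defines "G \<equiv> 2 * g * (1 - g) * (q / E + Q / e - q * X - Q * x - q * y - Q * Y)"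
    and "C \<equiv> 2 * (g * (e * q * X - E * Q * x) - (1 - g) * (e * q * y - E * Q * Y))"
  shows "4 * g * (1 - g) / (e * E) * (Q * (2 * x - 1) - q * (1 - 2 * y) * e / E)
    + w * (4 * g * (q * X / E - Q * x / e)) = - 2 * G / E - 2 * g * C / E\<^sup>2" (is "?l = ?r")
proof -
  have e: "e = 2 - E" using assms(1) by (simp add: algebra_simps)
  \<comment> \<open>e E^2 is a common denominator of both sides; the resulting polynomial identity
    follows from e + E = 2.\<close>
  have "?l * (e * E\<^sup>2) = 4 * g * (1 - g) * (E * Q * (2 * x - 1) - q * (1 - 2 * y) * e)
      + (E - 2 * g) * (4 * g * (e * q * X - E * Q * x))"
    using assms(2,3) by (simp add: assms(4) power2_eq_square field_simps)
  also have "\<dots> = - 2 * (2 * g * (1 - g) * (q * e + Q * E - e * E * (q * X + Q * x + q * y + Q * Y)))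
      - 2 * g * C * e"
    unfolding C_def e by (simp add: algebra_simps)
  also have "\<dots> = ?r * (e * E\<^sup>2)"
    using assms(2,3) unfolding G_def by (simp add: power2_eq_square field_simps)
  finally show ?thesis using assms(2,3) by simp
qed

lemma of_real_Re_eq: "2 * complex_of_real (Re z) = z + cnj z"
  by (simp add: complex_eq_iff)

lemma of_real_Im_eq: "2 * \<i> * complex_of_real (Im z) = z - cnj z"
  by (simp add: complex_eq_iff)

section \<open>The flow of the Verblunsky coefficients and of \<omega>\<close>

context circle_deformation
begin

text \<open>The index is shifted by one: \<open>\<alpha>\<^sub>p t n\<close> is the Verblunsky coefficient of index \<open>n - 1\<close>, with the
  convention that the one of index \<open>-1\<close> is \<open>-1\<close>.\<close>

definition \<alpha>\<^sub>p :: "real \<Rightarrow> nat \<Rightarrow> complex" where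
  "\<alpha>\<^sub>p t n = (case n of 0 \<Rightarrow> - 1 | Suc k \<Rightarrow> N.\<alpha> t k)"

lemma poly_monic_op_0: "poly (N.\<Phi> t n) 0 = - cnj (\<alpha>\<^sub>p t n)"
  by (cases n) (simp_all add: \<alpha>\<^sub>p_def N.monic_op_0 verblunsky_def)

lemma has_vector_derivative_verblunsky:
  "((\<lambda>s. N.\<alpha> s n) has_vector_derivative
     of_real (1 - (cmod (N.\<alpha> t n))\<^sup>2) * (cnj q * \<alpha>\<^sub>p t n - q * N.\<alpha> t (Suc n))) (at t)"
proof -
  have "((\<lambda>s. N.\<alpha> s n) has_vector_derivative
      - cnj (of_real (1 - (cmod (N.\<alpha> t n))\<^sup>2) *
      (q * poly (N.\<Phi> t n) 0 + cnj q * cnj (N.\<alpha> t (Suc n)) * poly (N.\<Phi>r t n) 0))) (at t)"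
    unfolding verblunsky_def
    by (intro has_vector_derivative_minus has_vector_derivative_cnj
        has_vector_derivative_monic_op[unfolded verblunsky_def])
  then show ?thesis
    by (rule has_vector_derivative_eq_rhs)
      (simp add: N.poly_reciprocal_op_0 poly_monic_op_0 algebra_simps)
qed

text \<open>Inverting the Szego recurrence at 1 writes (1 - |a_{n-1}|^2) Phi_{n-1}(1) through
  Phi_n(1) and its conjugate, so the index n - 1 survives only in \<open>\<alpha>\<^sub>p\<close>.
  The convention a_{-1} = -1 yields derivative 0 for n = 0.\<close>

lemma has_vector_derivative_monic_op_1:
  fixes t n
  defines "P \<equiv> poly (N.\<Phi> t n) 1"
  shows "((\<lambda>s. poly (N.\<Phi> s n) 1) has_vector_derivative
     q * (P + cnj (\<alpha>\<^sub>p t n) * cnj P) + cnj q * cnj (N.\<alpha> t n) * (cnj P + \<alpha>\<^sub>p t n * P)) (at t)"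
proof (cases n)
  case 0
  then show ?thesis by (simp add: P_def N.monic_op_0 \<alpha>\<^sub>p_def)
next
  case (Suc m)
  let ?k = "complex_of_real (1 - (cmod (N.\<alpha> t m))\<^sup>2)" and ?p = "poly (N.\<Phi> t m) 1"
  have k: "?k = 1 - N.\<alpha> t m * cnj (N.\<alpha> t m)"
    by (simp add: complex_norm_square del: of_real_power flip: of_real_power)
  have P: "P = ?p - cnj (N.\<alpha> t m) * cnj ?p" "cnj P = cnj ?p - N.\<alpha> t m * ?p"
    by (simp_all add: P_def Suc N.poly_monic_op_Suc_1)
  have *: "?k * ?p = P + cnj (\<alpha>\<^sub>p t n) * cnj P" "?k * cnj ?p = cnj P + \<alpha>\<^sub>p t n * P"
    unfolding k P by (simp_all add: \<alpha>\<^sub>p_def Suc algebra_simps)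
  have "((\<lambda>s. poly (N.\<Phi> s n) 1) has_vector_derivative
     ?k * (q * ?p + cnj q * cnj (N.\<alpha> t n) * cnj ?p)) (at t)"
    using has_vector_derivative_monic_op[of m 1 t] by (simp add: Suc N.poly_reciprocal_op_1)
  also have "?k * (q * ?p + cnj q * cnj (N.\<alpha> t n) * cnj ?p) =
      q * (?k * ?p) + cnj q * cnj (N.\<alpha> t n) * (?k * cnj ?p)"
    by (simp only: algebra_simps)
  finally show ?thesis unfolding * .
qed

lemma has_vector_derivative_\<omega>:
  fixes t n
  defines "w \<equiv> N.\<omega> t n" and "u \<equiv> \<alpha>\<^sub>p t n * op_rho (N t) n"
    and "y \<equiv> N.\<alpha> t (Suc n) * op_rho (N t) n"
  shows "((\<lambda>s. N.\<omega> s n) has_vector_derivative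
     of_real (1 - (cmod w)\<^sup>2) * (cnj q * u - q * y)
     + w * ((q * cnj u + cnj q * cnj w * u) - cnj (q * cnj u + cnj q * cnj w * u)
            + (q + cnj q * cnj w) - cnj (q + cnj q * cnj w))) (at t)"
proof -
  let ?P = "poly (N.\<Phi> t n) 1" and ?a = "N.\<alpha> t n" and ?b = "\<alpha>\<^sub>p t n"
  let ?P' = "q * (?P + cnj ?b * cnj ?P) + cnj q * cnj ?a * (cnj ?P + ?b * ?P)"
  let ?a' = "of_real (1 - (cmod ?a)\<^sup>2) * (cnj q * ?b - q * N.\<alpha> t (Suc n))"
  \<comment> \<open>B is the logarithmic derivative of Phi_n(1), so that of rho_n is the purely
    imaginary \<open>B - cnj B\<close>.\<close>
  define B where "B = q * cnj u + cnj q * cnj w * u + (q + cnj q * cnj w)"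
  have P: "?P \<noteq> 0" by (rule N.poly_monic_op_1_nonzero)
  have r: "op_rho (N t) n = ?P / cnj ?P" by (rule N.op_rho_eq)
  have P': "?P' = ?P * B"
    using P unfolding B_def u_def w_def N.\<omega>_def r by (simp add: field_simps)
  have "((\<lambda>s. poly (N.\<Phi> s n) 1 / cnj (poly (N.\<Phi> s n) 1) * N.\<alpha> s n) has_vector_derivative
      (?P / cnj ?P * ?a' + (?P' * cnj ?P - ?P * cnj ?P') / (cnj ?P * cnj ?P) * ?a)) (at t)"
    using P
    by (intro has_vector_derivative_mult has_vector_derivative_quotient has_vector_derivative_cnj
        has_vector_derivative_monic_op_1 has_vector_derivative_verblunsky) simp
  also have "(\<lambda>s. poly (N.\<Phi> s n) 1 / cnj (poly (N.\<Phi> s n) 1) * N.\<alpha> s n) = (\<lambda>s. N.\<omega> s n)"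
    by (simp add: N.\<omega>_def N.op_rho_eq)
  also have "?P / cnj ?P * ?a' = of_real (1 - (cmod w)\<^sup>2) * (cnj q * u - q * y)"
    unfolding u_def y_def w_def N.cmod_\<omega> r [symmetric] by (simp add: algebra_simps)
  also have "(?P' * cnj ?P - ?P * cnj ?P') / (cnj ?P * cnj ?P) * ?a = w * (B - cnj B)"
    unfolding P' w_def N.\<omega>_def r using P by (simp add: field_simps)
  finally show ?thesis by (simp add: B_def algebra_simps)
qed

text \<open>The value \<open>0\<close> at \<open>n = 0\<close> plays the role of \<open>1 - g_0\<close>, as \<^term>\<open>kernel_g\<close> and \<^term>\<open>kernel_c\<close> are
  junk there; it encodes \<open>d_1 = 0\<close> and lets one formula cover the case \<open>n = 1\<close> of the flow.\<close>

definition \<delta> :: "real \<Rightarrow> nat \<Rightarrow> real" where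
  "\<delta> t n = (if n = 0 then 0 else 1 - N.\<gamma> t n)"

text \<open>Moving rho from index n - 1 to n multiplies by a known phase, so the product is \<omega>
  at n - 1 times that phase. For n = 0 the value \<open>\<delta> t 0 = 0\<close> reproduces a_{-1} =
  -1.\<close>

lemma \<alpha>\<^sub>p_mult_op_rho:
  "\<alpha>\<^sub>p t n * op_rho (N t) n = 2 * (of_real (\<delta> t n) / (1 + \<i> * of_real (N.\<eta> t n))) - 1"
proof (cases n)
  case 0
  then show ?thesis by (simp add: \<alpha>\<^sub>p_def \<delta>_def N.op_rho_eq N.monic_op_0)
next
  case (Suc m)
  define e e' where "e = 1 + \<i> * complex_of_real (N.\<eta> t n)" and "e' = 1 - \<i> * complex_of_real (N.\<eta> t n)"
  have e: "e \<noteq> 0" "e' \<noteq> 0" "e' = 2 - e" by (simp_all add: e_def e'_def complex_eq_iff)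
  have "\<alpha>\<^sub>p t n * op_rho (N t) n = N.\<omega> t m * (e' / e)"
    by (simp add: Suc \<alpha>\<^sub>p_def N.op_rho_Suc N.one_minus_\<omega>_ratio[symmetric] N.\<omega>_def e_def e'_def)
  also have "\<dots> = (e' - 2 * of_real (N.\<gamma> t n)) / e"
    using e(2) unfolding N.\<omega>_eq Suc[symmetric] e'_def[symmetric]
    by (simp add: diff_divide_distrib left_diff_distrib)
  also have "\<dots> = 2 * ((1 - of_real (N.\<gamma> t n)) / e) - 1"
    using e(1) unfolding e(3) by (simp add: field_simps)
  finally show ?thesis by (simp add: e_def \<delta>_def Suc)
qed

text \<open>The counterpart at the upper neighbour: rho_n is rho_{n+1} times the inverse
  phase.\<close>

lemma verblunsky_Suc_mult_op_rho:
  "N.\<alpha> t (Suc n) * op_rho (N t) n =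
    (1 - 2 * (of_real (N.\<gamma> t (n + 2)) / (1 - \<i> * of_real (N.\<eta> t (n + 2)))))
      * (1 + \<i> * of_real (N.\<eta> t (n + 1))) / (1 - \<i> * of_real (N.\<eta> t (n + 1)))"
proof -
  define e e' where "e = 1 + \<i> * complex_of_real (N.\<eta> t (n + 1))"
    and "e' = 1 - \<i> * complex_of_real (N.\<eta> t (n + 1))"
  have e: "e \<noteq> 0" "e' \<noteq> 0" by (simp_all add: e_def e'_def complex_eq_iff)
  have "op_rho (N t) (Suc n) = op_rho (N t) n * (e' / e)"
    using N.one_minus_\<omega>_ratio[of t n] by (simp add: N.op_rho_Suc e_def e'_def flip: times_divide_eq_right)
  then have "op_rho (N t) n = op_rho (N t) (Suc n) * (e / e')"
    using e by simp
  then have "N.\<alpha> t (Suc n) * op_rho (N t) n = N.\<omega> t (Suc n) * (e / e')"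
    by (simp add: N.\<omega>_def)
  then show ?thesis by (simp add: N.\<omega>_eq e_def e'_def)
qed

text \<open>The real part of q / (1 - i c_k).\<close>

definition E :: "real \<Rightarrow> nat \<Rightarrow> real" where
  "E t k = (Re q - Im q * N.\<eta> t k) / (1 + (N.\<eta> t k)\<^sup>2)"

text \<open>The imaginary part of (1 + i c_n) q / (1 - i c_k).\<close>

definition F :: "real \<Rightarrow> nat \<Rightarrow> nat \<Rightarrow> real" where
  "F t n k = (Re q * (N.\<eta> t n + N.\<eta> t k) + Im q * (1 - N.\<eta> t n * N.\<eta> t k)) / (1 + (N.\<eta> t k)\<^sup>2)"

section \<open>The derivatives of g, c and d\<close>

lemma of_real_divide_one_minus_ii:
  "of_real a / (1 - \<i> * of_real c) = of_real (a / (1 + c\<^sup>2)) * (1 + \<i> * of_real c)"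
proof -
  have "1 - \<i> * complex_of_real c \<noteq> 0" "1 + complex_of_real c ^ 2 \<noteq> 0"
    by (simp_all add: complex_eq_iff power2_eq_square add_nonneg_eq_0_iff)
  then show ?thesis by (simp add: field_simps power2_eq_square)
qed

lemma Re_q_div: "Re (q * (of_real a / (1 - \<i> * of_real (N.\<eta> t k)))) = a * E t k"
  unfolding of_real_divide_one_minus_ii by (simp add: E_def algebra_simps add_divide_distrib diff_divide_distrib)

lemma Im_q_div:
  "Im ((1 + \<i> * of_real (N.\<eta> t n)) * q * (of_real a / (1 - \<i> * of_real (N.\<eta> t k)))) = a * F t n k"
  unfolding of_real_divide_one_minus_ii by (simp add: F_def algebra_simps add_divide_distrib diff_divide_distrib)

text \<open>\<open>flow_identity\<close> puts the derivative of \<omega> into the form that formal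
  differentiation of 1 - 2 g / (1 - i c) would give, with G and C as derivatives of g and c. Its
  real and imaginary parts, inserted into the formulas for c and g in terms of \<omega>, then prove
  that G and C are the derivatives.\<close>

lemma kernel_derivatives:
  fixes t n
  defines "G \<equiv> 4 * N.\<gamma> t (n + 1) * (1 - N.\<gamma> t (n + 1)) *
      (E t (n + 1) - \<delta> t n * E t n - N.\<gamma> t (n + 2) * E t (n + 2))"
    and "C \<equiv> 4 * (\<delta> t n * N.\<gamma> t (n + 1) * F t (n + 1) n
      - (1 - N.\<gamma> t (n + 1)) * N.\<gamma> t (n + 2) * F t (n + 1) (n + 2))"
  shows has_real_derivative_kernel_g: "((\<lambda>s. N.\<gamma> s (n + 1)) has_real_derivative G) (at t)"
    and has_real_derivative_kernel_c: "((\<lambda>s. N.\<eta> s (n + 1)) has_real_derivative C) (at t)"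
proof -
  define g c h where "g = N.\<gamma> t (n + 1)" and "c = N.\<eta> t (n + 1)" and "h = 1 + c\<^sup>2"
  define e e' where "e = 1 + \<i> * complex_of_real c" and "e' = 1 - \<i> * complex_of_real c"
  define x where "x = of_real (\<delta> t n) / (1 + \<i> * complex_of_real (N.\<eta> t n))"
  define y where "y = of_real (N.\<gamma> t (n + 2)) / (1 - \<i> * complex_of_real (N.\<eta> t (n + 2)))"
  define w where "w = N.\<omega> t n"
  have e: "e + e' = 2" "e \<noteq> 0" "e' \<noteq> 0" "cnj e = e'" "cnj e' = e" "e * e' = of_real h"
    by (simp_all add: e_def e'_def h_def complex_eq_iff power2_eq_square)
  have w: "w = 1 - 2 * of_real g / e'"
    by (simp add: w_def g_def e'_def c_def N.\<omega>_eq)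
  have h: "h > 0" by (simp add: h_def add_pos_nonneg)
  have g: "g > 0" using N.kernel_g_pos[of t n] by (simp add: g_def)
  have Re_w: "1 - Re w = 2 * g / h"
    using N.kernel_g_Suc[of t n] h by (simp add: w_def g_def h_def c_def field_simps)
  have "1 - (cmod w)\<^sup>2 = 2 * (1 - Re w) * (1 - g)"
    using N.one_minus_norm_verblunsky[of t n] by (simp add: N.cmod_\<omega> w_def g_def)
  then have "1 - (cmod w)\<^sup>2 = 4 * g * (1 - g) / h" unfolding Re_w by simp
  then have norm_w: "complex_of_real (1 - (cmod w)\<^sup>2) = 4 * of_real g * (1 - of_real g) / (e * e')"
    by (simp add: e)
  define D where "D = of_real (1 - (cmod w)\<^sup>2) * (cnj q * (2 * x - 1) - q * (1 - 2 * y) * e / e')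
     + w * ((q * cnj (2 * x - 1) + cnj q * cnj w * (2 * x - 1)) - cnj (q * cnj (2 * x - 1) + cnj q * cnj w * (2 * x - 1))
            + (q + cnj q * cnj w) - cnj (q + cnj q * cnj w))"
  have dw: "((\<lambda>s. N.\<omega> s n) has_vector_derivative D) (at t)"
    using has_vector_derivative_\<omega>[of n t, unfolded \<alpha>\<^sub>p_mult_op_rho verblunsky_Suc_mult_op_rho]
    unfolding D_def w_def x_def y_def e_def e'_def c_def by (simp only: mult.assoc times_divide_eq_right)
  \<comment> \<open>The -1 in \<open>2 * x - 1\<close> cancels against the terms
    \<open>q + cnj q * cnj w\<close>; what is left contains 1 - w = 2 g / e' and its conjugate, as
    \<open>flow_identity\<close> needs.\<close>
  have "(q * cnj (2 * x - 1) + cnj q * cnj w * (2 * x - 1)) - cnj (q * cnj (2 * x - 1) + cnj q * cnj w * (2 * x - 1))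
            + (q + cnj q * cnj w) - cnj (q + cnj q * cnj w)
      = 2 * q * cnj x * (1 - w) - 2 * cnj q * x * (1 - cnj w)"
    by (simp add: algebra_simps)
  also have "\<dots> = 4 * of_real g * (q * cnj x / e' - cnj q * x / e)"
    unfolding w by (simp add: e algebra_simps)
  finally have "D = - 2 * of_real G / e' - 2 * of_real g * (\<i> * of_real C) / e'\<^sup>2"
    unfolding D_def norm_w
  proof (simp only:, subst flow_identity[OF e(1-3) w, of "cnj q" x q y "cnj x" "cnj y"])
    \<comment> \<open>Writing G and C through Re and Im lets 2 Re z = z + conj z and 2 i Im z = z -
      conj z produce the complex sums of \<open>flow_identity\<close>.\<close>
    have G: "G = 4 * g * (1 - g) * Re (q * (of_real 1 / e') - q * cnj x - q * y)"
      unfolding G_def minus_complex.sel x_def y_def e'_def c_def g_def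
      by (simp only: Re_q_div complex_cnj_divide complex_cnj_add complex_cnj_mult complex_cnj_i
          complex_cnj_complex_of_real complex_cnj_one) (use Re_q_div in simp)
    have C: "C = 4 * (g * Im (e * q * cnj x) - (1 - g) * Im (e * q * y))"
      unfolding C_def x_def y_def e_def c_def g_def using Im_q_div by simp
    show "- 2 * (2 * of_real g * (1 - of_real g) * (q / e' + cnj q / e - q * cnj x - cnj q * x - q * y - cnj q * cnj y)) / e'
       - 2 * of_real g * (2 * (of_real g * (e * q * cnj x - e' * cnj q * x) - (1 - of_real g) * (e * q * y - e' * cnj q * cnj y))) / e'\<^sup>2
      = - 2 * of_real G / e' - 2 * of_real g * (\<i> * of_real C) / e'\<^sup>2"
    proof -
      have "complex_of_real G = 2 * of_real g * (1 - of_real g) * (2 * of_real (Re (q * (of_real 1 / e') - q * cnj x - q * y)))"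
        unfolding G by simp
      then have 1: "complex_of_real G = 2 * of_real g * (1 - of_real g) * (q / e' + cnj q / e - q * cnj x - cnj q * x - q * y - cnj q * cnj y)"
        unfolding of_real_Re_eq by (simp add: e algebra_simps)
      have "\<i> * complex_of_real C = 2 * (of_real g * (2 * \<i> * of_real (Im (e * q * cnj x)))
          - (1 - of_real g) * (2 * \<i> * of_real (Im (e * q * y))))"
        unfolding C by (simp add: algebra_simps)
      then have 2: "\<i> * complex_of_real C = 2 * (of_real g * (e * q * cnj x - e' * cnj q * x)
          - (1 - of_real g) * (e * q * y - e' * cnj q * cnj y))"
        unfolding of_real_Im_eq by (simp add: e)
      show ?thesis unfolding 1 2 ..
    qed
  qed
  \<comment> \<open>Use 1 / e' = e / h, after which real and imaginary parts can be read
    off.\<close>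
  then have D: "D = of_real (- 2 * G / h) * e - of_real (2 * g * C / h\<^sup>2) * (\<i> * e\<^sup>2)"
    using e h by (simp add: field_simps power2_eq_square flip: e(6))
  have ReD: "Re D = - 2 * G / h + 4 * g * C * c / h\<^sup>2"
    and ImD: "Im D = - 2 * G * c / h - 2 * g * C * (1 - c\<^sup>2) / h\<^sup>2"
    unfolding D by (simp_all add: e_def power2_eq_square)
  have dRe: "((\<lambda>s. Re (N.\<omega> s n)) has_real_derivative Re D) (at t)"
    and dIm: "((\<lambda>s. Im (N.\<omega> s n)) has_real_derivative Im D) (at t)"
    using dw by (auto simp: has_vector_derivative_complex_iff)
  have r: "Re w - 1 = - 2 * g / h" using Re_w by simp
  have "c = Im w / (Re w - 1)" by (simp add: c_def w_def N.kernel_c_Suc)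
  then have Im_w: "Im w = - 2 * g * c / h" unfolding r using g h by (simp add: field_simps)
  have nz: "Re w - 1 \<noteq> 0" unfolding r using g h by simp
  have "((\<lambda>s. Im (N.\<omega> s n) / (Re (N.\<omega> s n) - 1)) has_real_derivative
      (Im D * (Re w - 1) - Im w * (Re D - 0)) / ((Re w - 1) * (Re w - 1))) (at t)"
    unfolding w_def by (intro DERIV_divide DERIV_diff dRe dIm DERIV_const nz[unfolded w_def])
  moreover have "(Im D * (Re w - 1) - Im w * (Re D - 0)) / ((Re w - 1) * (Re w - 1)) = C"
  proof -
    have "Im D * (Re w - 1) - Im w * (Re D - 0) = (2 * g / h) * (c * Re D - Im D)"
      unfolding r Im_w by (simp add: algebra_simps diff_divide_distrib)
    also have "c * Re D - Im D = 2 * g * C * (1 + c\<^sup>2) / h\<^sup>2"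
      unfolding ReD ImD using h by (simp add: field_simps power2_eq_square)
    also have "\<dots> = 2 * g * C / h"
      using h unfolding h_def[symmetric] by (simp add: power2_eq_square)
    finally show ?thesis unfolding r using g h by (simp add: field_simps)
  qed
  ultimately show dc: "((\<lambda>s. N.\<eta> s (n + 1)) has_real_derivative C) (at t)"
    by (simp add: N.kernel_c_Suc)
  have "((\<lambda>s. 1 / 2 * (1 - Re (N.\<omega> s n)) * (1 + (N.\<eta> s (n + 1))\<^sup>2)) has_real_derivative
      1 / 2 * (1 - Re w) * (2 * c * C) + 1 / 2 * - Re D * (1 + c\<^sup>2)) (at t)"
    unfolding w_def c_def by (auto intro!: derivative_eq_intros dw dc[simplified] simp: algebra_simps)
  moreover have "1 / 2 * (1 - Re w) * (2 * c * C) + 1 / 2 * - Re D * (1 + c\<^sup>2) = G"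
    unfolding h_def[symmetric] Re_w ReD using h by (simp add: field_simps power2_eq_square)
  ultimately show "((\<lambda>s. N.\<gamma> s (n + 1)) has_real_derivative G) (at t)"
    by (simp add: N.kernel_g_Suc)
qed

text \<open>In the product rule for (1 - g_{n+1}) g_{n+2}, the terms at n + 1 and n + 2 both collect
  the factor 1 - g_{n+2} + g_{n+1} g_{n+2} = 1 - d_{n+2}, with opposite signs.\<close>

lemma has_real_derivative_kernel_d:
  "((\<lambda>s. kernel_d (N s) (n + 2)) has_real_derivative
     4 * kernel_d (N t) (n + 2) * (\<delta> t n * N.\<gamma> t (n + 1) * E t n - kernel_d (N t) (n + 3) * E t (n + 3)
       + (1 - kernel_d (N t) (n + 2)) * (E t (n + 2) - E t (n + 1)))) (at t)"
proof -
  have d: "kernel_d (N s) (n + 2) = (1 - N.\<gamma> s (n + 1)) * N.\<gamma> s (n + 1 + 1)"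
    and d': "kernel_d (N s) (n + 3) = (1 - N.\<gamma> s (n + 1 + 1)) * N.\<gamma> s (n + 1 + 2)" for s
    by (simp_all add: kernel_d_def numeral_3_eq_3)
  have \<delta>: "\<delta> t (n + 1) = 1 - N.\<gamma> t (n + 1)" by (simp add: \<delta>_def)
  have "((\<lambda>s. (1 - N.\<gamma> s (n + 1)) * N.\<gamma> s (n + 1 + 1)) has_real_derivative
      (0 - 4 * N.\<gamma> t (n + 1) * (1 - N.\<gamma> t (n + 1)) *
          (E t (n + 1) - \<delta> t n * E t n - N.\<gamma> t (n + 2) * E t (n + 2))) * N.\<gamma> t (n + 1 + 1)
      + 4 * N.\<gamma> t (n + 1 + 1) * (1 - N.\<gamma> t (n + 1 + 1)) *
          (E t (n + 1 + 1) - \<delta> t (n + 1) * E t (n + 1) - N.\<gamma> t (n + 1 + 2) * E t (n + 1 + 2))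
        * (1 - N.\<gamma> t (n + 1))) (at t)"
    by (intro DERIV_mult DERIV_diff DERIV_const has_real_derivative_kernel_g)
  then show ?thesis
    unfolding d d' \<delta> by (rule DERIV_cong) (simp add: algebra_simps numeral_3_eq_3)
qed

end

section \<open>Recurrence and flow for the families c, d and R\<close>

theorem theorem5:
  fixes \<mu> :: "complex measure" and q :: complex
    and c d :: "nat \<Rightarrow> real \<Rightarrow> real" and R :: "nat \<Rightarrow> complex \<Rightarrow> real \<Rightarrow> complex"
  assumes "unit_circle_measure \<mu>"
    and "infinite (measure_support \<mu>)"
    and "\<And>n z t. R n z t = kernel_R (deformed_measure \<mu> q t) n z"
    and "\<And>t. c 0 t = 1"
    and "\<And>n t. n \<ge> 1 \<Longrightarrow> c n t = kernel_c (deformed_measure \<mu> q t) n"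
    and "\<And>t. d 1 t = 0"
    and "\<And>n t. n \<ge> 2 \<Longrightarrow> d n t = kernel_d (deformed_measure \<mu> q t) n"
  shows "(\<forall>t z. R 0 z t = 1)
    \<and> (\<forall>t z. R 1 z t = (1 + \<i> * of_real (c 1 t)) * z + (1 - \<i> * of_real (c 1 t)))
    \<and> (\<forall>n\<ge>1. \<forall>t z. R (n + 1) z t =
          ((1 + \<i> * of_real (c (n + 1) t)) * z + (1 - \<i> * of_real (c (n + 1) t))) * R n z t
          - 4 * of_real (d (n + 1) t) * z * R (n - 1) z t)
    \<and> (\<forall>t. ((\<lambda>s. c 1 s) has_real_derivative
          (- 4 * Re q * (d 2 t * (c 1 t + c 2 t) / (1 + (c 2 t)\<^sup>2))
           - 4 * Im q * (d 2 t * (1 - c 1 t * c 2 t) / (1 + (c 2 t)\<^sup>2)))) (at t))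
    \<and> (\<forall>n\<ge>2. \<forall>t. ((\<lambda>s. c n s) has_real_derivative
          (4 * Re q * (d n t * (c n t + c (n - 1) t) / (1 + (c (n - 1) t)\<^sup>2)
                       - d (n + 1) t * (c n t + c (n + 1) t) / (1 + (c (n + 1) t)\<^sup>2))
           + 4 * Im q * (d n t * (1 - c n t * c (n - 1) t) / (1 + (c (n - 1) t)\<^sup>2)
                       - d (n + 1) t * (1 - c n t * c (n + 1) t) / (1 + (c (n + 1) t)\<^sup>2)))) (at t))
    \<and> (\<forall>n\<ge>2. \<forall>t. ((\<lambda>s. d n s) has_real_derivative
          (4 * Re q * (d n t * d (n - 1) t / (1 + (c (n - 2) t)\<^sup>2)
                       - d n t * d (n + 1) t / (1 + (c (n + 1) t)\<^sup>2)
                       + d n t * (1 - d n t) * ((c (n - 1) t)\<^sup>2 - (c n t)\<^sup>2)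
                         / ((1 + (c n t)\<^sup>2) * (1 + (c (n - 1) t)\<^sup>2)))
           - 4 * Im q * (d n t * d (n - 1) t * c (n - 2) t / (1 + (c (n - 2) t)\<^sup>2)
                       - d n t * d (n + 1) t * c (n + 1) t / (1 + (c (n + 1) t)\<^sup>2)
                       + d n t * (1 - d n t) * (c n t - c (n - 1) t) * (1 - c n t * c (n - 1) t)
                         / ((1 + (c n t)\<^sup>2) * (1 + (c (n - 1) t)\<^sup>2))))) (at t))"
proof -
  interpret circle_deformation \<mu> q
    by unfold_locales fact+
  have c: "N.\<eta> t n = c n t" if "n \<ge> 1" for n t using assms(5)[OF that] by simp
  have d: "kernel_d (N t) n = d n t" if "n \<ge> 2" for n t using assms(7)[OF that] by simp
  \<comment> \<open>For n = 0 both sides are 0, which merges the boundary case with the general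
    one.\<close>
  have \<delta>: "\<delta> t n * N.\<gamma> t (n + 1) = d (n + 1) t" for n t
    using assms(6) d[of "n + 1" t] by (cases n) (auto simp: \<delta>_def kernel_d_def)
  have \<gamma>: "(1 - N.\<gamma> t (n + 1)) * N.\<gamma> t (n + 2) = d (n + 2) t" for n t
    using d[of "n + 2" t] by (simp add: kernel_d_def)
  have dc: "((\<lambda>s. c (n + 1) s) has_real_derivative
      4 * (d (n + 1) t * F t (n + 1) n - d (n + 2) t * F t (n + 1) (n + 2))) (at t)" for n t
    using has_real_derivative_kernel_c[of n t] unfolding \<delta> \<gamma> by (simp add: c)
  have dd: "((\<lambda>s. d (n + 2) s) has_real_derivative
     4 * d (n + 2) t * (d (n + 1) t * E t n - d (n + 3) t * E t (n + 3)
       + (1 - d (n + 2) t) * (E t (n + 2) - E t (n + 1)))) (at t)" for n t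
    using has_real_derivative_kernel_d[of n t] unfolding \<delta> by (simp add: d)
  have E: "E t n = (Re q - Im q * c n t) / (1 + (c n t)\<^sup>2)" if "n \<ge> 1" for n t
    using that by (simp add: E_def c)
  have F: "F t m n = (Re q * (c m t + c n t) + Im q * (1 - c m t * c n t)) / (1 + (c n t)\<^sup>2)"
    if "m \<ge> 1" "n \<ge> 1" for m n t
    using that by (simp add: F_def c)
  show ?thesis
  proof (intro conjI allI impI)
    fix t z
    show "R 0 z t = 1" by (simp add: assms(3) N.kernel_R_0)
    show "R 1 z t = (1 + \<i> * of_real (c 1 t)) * z + (1 - \<i> * of_real (c 1 t))"
      unfolding assms(3) by (simp only: N.kernel_R_1 c order.refl)
  next
    fix n :: nat and t z assume "n \<ge> 1"
    then show "R (n + 1) z t =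
          ((1 + \<i> * of_real (c (n + 1) t)) * z + (1 - \<i> * of_real (c (n + 1) t))) * R n z t
          - 4 * of_real (d (n + 1) t) * z * R (n - 1) z t"
      unfolding assms(3) by (subst N.kernel_R_recurrence) (simp_all add: c d)
  next
    fix t
    show "((\<lambda>s. c 1 s) has_real_derivative
          (- 4 * Re q * (d 2 t * (c 1 t + c 2 t) / (1 + (c 2 t)\<^sup>2))
           - 4 * Im q * (d 2 t * (1 - c 1 t * c 2 t) / (1 + (c 2 t)\<^sup>2)))) (at t)"
      using dc[of 0 t] assms(6) by (simp add: F algebra_simps add_divide_distrib diff_divide_distrib numeral_2_eq_2)
  next
    fix n :: nat and t assume "n \<ge> 2"
    then obtain m where n: "n = m + 1" "m \<ge> 1" by (metis Suc_eq_plus1 Suc_le_D Suc_1 Suc_le_mono One_nat_def)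
    have "4 * (d (m + 1) t * F t (m + 1) m - d (m + 2) t * F t (m + 1) (m + 2)) =
       (4 * Re q * (d n t * (c n t + c (n - 1) t) / (1 + (c (n - 1) t)\<^sup>2)
                       - d (n + 1) t * (c n t + c (n + 1) t) / (1 + (c (n + 1) t)\<^sup>2))
           + 4 * Im q * (d n t * (1 - c n t * c (n - 1) t) / (1 + (c (n - 1) t)\<^sup>2)
                       - d (n + 1) t * (1 - c n t * c (n + 1) t) / (1 + (c (n + 1) t)\<^sup>2)))"
      unfolding n using n(2) by (simp add: F add_divide_distrib diff_divide_distrib algebra_simps)
    then show "((\<lambda>s. c n s) has_real_derivative
          (4 * Re q * (d n t * (c n t + c (n - 1) t) / (1 + (c (n - 1) t)\<^sup>2)
                       - d (n + 1) t * (c n t + c (n + 1) t) / (1 + (c (n + 1) t)\<^sup>2))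
           + 4 * Im q * (d n t * (1 - c n t * c (n - 1) t) / (1 + (c (n - 1) t)\<^sup>2)
                       - d (n + 1) t * (1 - c n t * c (n + 1) t) / (1 + (c (n + 1) t)\<^sup>2)))) (at t)"
      using dc[of m t] unfolding n(1) by (rule DERIV_cong[rotated])
  next
    fix n :: nat and t assume "n \<ge> 2"
    then obtain m where n: "n = m + 2" by (metis add.commute le_Suc_ex)
    define a b where "a = 1 + (c (m + 1) t)\<^sup>2" and "b = 1 + (c (m + 2) t)\<^sup>2"
    have ab: "a \<noteq> 0" "b \<noteq> 0" by (simp_all add: a_def b_def add_nonneg_eq_0_iff)
    \<comment> \<open>For m = 0 the value \<open>c 0 t = 1\<close> need not agree with
      \<open>kernel_c\<close> at 0, but the factor \<open>d 1 t = 0\<close> annihilates both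
      sides.\<close>
    have Ed: "d (m + 1) t * E t m = d (m + 1) t * ((Re q - Im q * c m t) / (1 + (c m t)\<^sup>2))"
      using assms(6) by (cases "m = 0") (simp_all add: E)
    \<comment> \<open>Over the common denominator the coefficient of \<open>Im q\<close> factors,
      which explains the product (c_n - c_{n-1}) (1 - c_n c_{n-1}) in the claim.\<close>
    have EE: "E t (m + 2) - E t (m + 1) = Re q * (((c (m + 1) t)\<^sup>2 - (c (m + 2) t)\<^sup>2) / (b * a))
       - Im q * ((c (m + 2) t - c (m + 1) t) * (1 - c (m + 2) t * c (m + 1) t) / (b * a))"
    proof -
      have "E t (m + 2) = (Re q - Im q * c (m + 2) t) / b" "E t (m + 1) = (Re q - Im q * c (m + 1) t) / a"
        by (simp_all add: E a_def b_def)
      then have "E t (m + 2) - E t (m + 1) =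
          ((Re q - Im q * c (m + 2) t) * a - (Re q - Im q * c (m + 1) t) * b) / (b * a)"
        using ab by (simp add: diff_frac_eq mult.commute)
      also have "(Re q - Im q * c (m + 2) t) * a - (Re q - Im q * c (m + 1) t) * b =
          Re q * ((c (m + 1) t)\<^sup>2 - (c (m + 2) t)\<^sup>2)
          - Im q * ((c (m + 2) t - c (m + 1) t) * (1 - c (m + 2) t * c (m + 1) t))"
        by (simp add: a_def b_def algebra_simps power2_eq_square)
      finally show ?thesis by (subst (asm) diff_divide_distrib) simp
    qed
    have "4 * d (m + 2) t * (d (m + 1) t * E t m - d (m + 3) t * E t (m + 3)
       + (1 - d (m + 2) t) * (E t (m + 2) - E t (m + 1))) =
      (4 * Re q * (d n t * d (n - 1) t / (1 + (c (n - 2) t)\<^sup>2)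
                       - d n t * d (n + 1) t / (1 + (c (n + 1) t)\<^sup>2)
                       + d n t * (1 - d n t) * ((c (n - 1) t)\<^sup>2 - (c n t)\<^sup>2)
                         / ((1 + (c n t)\<^sup>2) * (1 + (c (n - 1) t)\<^sup>2)))
           - 4 * Im q * (d n t * d (n - 1) t * c (n - 2) t / (1 + (c (n - 2) t)\<^sup>2)
                       - d n t * d (n + 1) t * c (n + 1) t / (1 + (c (n + 1) t)\<^sup>2)
                       + d n t * (1 - d n t) * (c n t - c (n - 1) t) * (1 - c n t * c (n - 1) t)
                         / ((1 + (c n t)\<^sup>2) * (1 + (c (n - 1) t)\<^sup>2))))" (is "_ = ?rhs")
    proof -
      have i: "n - 1 = m + 1" "n - 2 = m" "n + 1 = m + 3" by (simp_all add: n)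
      show ?thesis
        unfolding i unfolding n a_def[symmetric] b_def[symmetric] EE Ed
        by (simp add: E add_divide_distrib diff_divide_distrib algebra_simps)
    qed
    then show "((\<lambda>s. d n s) has_real_derivative ?rhs) (at t)"
      using dd[of m t] unfolding n by (rule DERIV_cong[rotated])
  qed
qed

end
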